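(* Let $\vartheta$ be an expanding primitive random substitution on a finite alphabet $\mathcal A$, let $\ell\in\mathbb N$ and let $v\in\mathcal L_\vartheta^\ell$ be a $\vartheta$-legal word of length $\ell$. Then, for any $a\in\mathcal A$, $$\lim_{n\to\infty}\frac{|\vartheta^n(a)|_v}{|\vartheta^n(a)|}=R_v^{(\ell)}$$ holds almost surely, where $R^{(\ell)}$ is the normalised right Perron–Frobenius eigenvector of the induced substitution matrix $M_{\vartheta_\ell}$.
   Context: Words. $\mathcal A$ is a finite alphabet, $\mathcal A^+=\bigcup_{n\ge 1}\mathcal A^n$ is the set of non-empty finite words, $|u|$ is the length of $u$, $u_{[k,m]}=u_k\cdots u_m$, and $|u|_v$ is the number of (possibly overlapping) occurrences of $v$ as a subword of $u$; $v\triangleleft u$ means $|u|_v\ge 1$. Random substitution. A random substitution $\vartheta$ on $\mathcal A$ is determined by a map $a\mapsto P^\vartheta_a$ assigning to each $a\in\mathcal A$ a finitely supported probability measure on $\mathcal A^+$. The transition kernel is $P(u_1\cdots u_m,v)=\sum_{v^1\cdots v^m=v}P^\vartheta_{u_1}(v^1)\cdots P^\vartheta_{u_m}(v^m)$ (sum over $v^1,\dots,v^m\in\mathcal A^+$ with concatenation $v$). For $u=u_1\cdots u_m\in\mathcal A^+$, $(\vartheta^n(u))_{n\ge 0}$ is the Markov chain on $\mathcal A^+$ with $\vartheta^0(u)=u$ and transition kernel $P$; it is realised on one probability space so that $\vartheta^n(u)=\vartheta^n(u_1)\cdots\vartheta^n(u_m)$ pointwise for all $n$, where $(\vartheta^n(u_1))_n,\dots,(\vartheta^n(u_m))_n$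 are independent Markov chains with kernel $P$ started at the letters $u_1,\dots,u_m$. The mean substitution matrix is $(M_\vartheta)_{ab}=\mathbb E|\vartheta(b)|_a$, $a,b\in\mathcal A$. $\vartheta$ is primitive if $M_\vartheta$ is a primitive matrix; a primitive $\vartheta$ is expanding if $\mathbb P[|\vartheta(a)|>1]>0$ for some $a\in\mathcal A$. Legal words. $\mathcal L_\vartheta=\{u\in\mathcal A^+: u\triangleleft v \text{ for some } v \text{ with } \mathbb P[\vartheta^n(a)=v]>0 \text{ for some } n\in\mathbb N, a\in\mathcal A\}$, and $\mathcal L_\vartheta^\ell$ is the set of elements of $\mathcal L_\vartheta$ of length $\ell$. Induced matrix. For $\ell\in\mathbb N$ let $\mathcal A_\ell=\mathcal L_\vartheta^\ell$. For $u=u_1\cdots u_\ell\in\mathcal A_\ell$ define the random word over the alphabet $\mathcal A_\ell$, $\vartheta_\ell(u)=(\vartheta(u)_{[k,k+\ell-1]})_{1\le k\le|\vartheta(u_1)|}$, and let $(M_{\vartheta_\ell})_{uv}=\mathbb E|\vartheta_\ell(v)|_u$ for $u,v\in\mathcal A_\ell$. It is known that for expanding primitive $\vartheta$ the matrix $M_{\vartheta_\ell}$ is primitive with the same Perron–Frobenius eigenvalue $\lambda$ as $M_\vartheta$. $R^{(\ell)}$ denotes its right Perron–Frobenius eigenvector with $\|R^{(\ell)}\|_1=1$. *)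

theory Defs
  imports "HOL-Probability.Probability"
begin

section \<open>Words\<close>

text \<open>Words are lists. \<open>occ v u\<close> is the number of possibly overlapping occurrences
  of \<open>v\<close> in \<open>u\<close>, counted by their starting positions. It is only meaningful for non-empty \<open>v\<close>.\<close>

definition occ :: "'b list \<Rightarrow> 'b list \<Rightarrow> nat" where
  "occ v u = card {k. k + length v \<le> length u \<and> take (length v) (drop k u) = v}"

section \<open>Random substitutions\<close>

text \<open>The alphabet is a finite type, and \<open>P a\<close> is the law of the image of the letter \<open>a\<close>.\<close>

definition random_substitution :: "('a::finite \<Rightarrow> 'a list pmf) \<Rightarrow> bool" where
  "random_substitution P \<longleftrightarrow> (\<forall>a. finite (set_pmf (P a)) \<and> [] \<notin> set_pmf (P a))"

text \<open>\<open>subst_blocks P u\<close> is the joint law of the independent images of the letters of \<open>u\<close>,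
  kept as a list of words. Concatenating them gives the transition kernel, see
  \<open>pmf_subst_kernel\<close> below.\<close>

fun subst_blocks :: "('a \<Rightarrow> 'a list pmf) \<Rightarrow> 'a list \<Rightarrow> 'a list list pmf" where
  "subst_blocks P [] = return_pmf []"
| "subst_blocks P (a # u) =
     bind_pmf (P a) (\<lambda>w. bind_pmf (subst_blocks P u) (\<lambda>ws. return_pmf (w # ws)))"

definition subst_kernel :: "('a \<Rightarrow> 'a list pmf) \<Rightarrow> 'a list \<Rightarrow> 'a list pmf" where
  "subst_kernel P u = map_pmf concat (subst_blocks P u)"

lemma pmf_subst_blocks:
  "pmf (subst_blocks P u) ws =
     (if length ws = length u then (\<Prod>i<length u. pmf (P (u ! i)) (ws ! i)) else 0)"
proof (induction u arbitrary: ws)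
  case Nil
  then show ?case by (auto simp: indicator_def)
next
  case (Cons a u)
  have eq: "subst_blocks P (a # u) = map_pmf (\<lambda>(w, ws). w # ws) (pair_pmf (P a) (subst_blocks P u))"
    by (simp add: pair_pmf_def map_bind_pmf)
  show ?case
  proof (cases ws)
    case Nil
    then have "ws \<notin> set_pmf (subst_blocks P (a # u))" by auto
    with Nil show ?thesis by (simp only: set_pmf_iff) auto
  next
    case (Cons w ws')
    have inj: "inj (\<lambda>(w, ws). w # ws)" by (auto simp: inj_def)
    have "pmf (subst_blocks P (a # u)) ws = pmf (pair_pmf (P a) (subst_blocks P u)) (w, ws')"
      using pmf_map_inj'[OF inj, of "pair_pmf (P a) (subst_blocks P u)" "(w, ws')"]
      by (simp only: eq Cons prod.case)
    also have "\<dots> = pmf (P a) w * pmf (subst_blocks P u) ws'" by (simp add: pmf_pair)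
    finally show ?thesis
      by (simp add: Cons Cons.IH lessThan_Suc_eq_insert_0 prod.reindex
          del: prod.lessThan_Suc subst_blocks.simps)
  qed
qed

lemma pmf_subst_kernel:
  fixes P :: "'a::finite \<Rightarrow> 'a list pmf"
  assumes "random_substitution P"
  shows "pmf (subst_kernel P u) v =
    (\<Sum>ws | length ws = length u \<and> [] \<notin> set ws \<and> concat ws = v.
       \<Prod>i<length u. pmf (P (u ! i)) (ws ! i))"
proof -
  define A where "A = {ws. length ws = length u \<and> concat ws = v}"
  define B where "B = {ws. length ws = length u \<and> [] \<notin> set ws \<and> concat ws = v}"
  have "A \<subseteq> {ws. set ws \<subseteq> {w. set w \<subseteq> UNIV \<and> length w \<le> length v} \<and> length ws = length u}"
    unfolding A_def by (auto simp: length_concat intro!: member_le_sum_list)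
  moreover have "finite {w::'a list. set w \<subseteq> UNIV \<and> length w \<le> length v}"
    by (rule finite_lists_length_le) simp
  ultimately have fin: "finite A"
    using finite_lists_length_eq finite_subset by blast
  have "pmf (subst_kernel P u) v = measure (subst_blocks P u) (concat -` {v})"
    by (simp add: subst_kernel_def pmf_map)
  also have "\<dots> = measure (subst_blocks P u) A"
    unfolding A_def
    by (rule measure_eq_AE) (auto simp: AE_measure_pmf_iff set_pmf_iff pmf_subst_blocks split: if_splits)
  also have "\<dots> = (\<Sum>ws\<in>A. pmf (subst_blocks P u) ws)"
    by (rule measure_measure_pmf_finite[OF fin])
  also have "\<dots> = (\<Sum>ws\<in>A. \<Prod>i<length u. pmf (P (u ! i)) (ws ! i))"
    by (rule sum.cong) (auto simp: A_def pmf_subst_blocks)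
  also have "\<dots> = (\<Sum>ws\<in>B. \<Prod>i<length u. pmf (P (u ! i)) (ws ! i))"
  proof (rule sum.mono_neutral_right[OF fin])
    show "B \<subseteq> A" by (auto simp: A_def B_def)
    show "\<forall>ws\<in>A - B. (\<Prod>i<length u. pmf (P (u ! i)) (ws ! i)) = 0"
    proof
      fix ws assume "ws \<in> A - B"
      then obtain i where i: "i < length u" "ws ! i = []"
        by (auto simp: A_def B_def in_set_conv_nth)
      have "pmf (P (u ! i)) (ws ! i) = 0"
        using assms i by (auto simp: random_substitution_def set_pmf_iff)
      with i show "(\<Prod>i<length u. pmf (P (u ! i)) (ws ! i)) = 0"
        by (intro prod_zero bexI[of _ i]) auto
    qed
  qed
  finally show ?thesis by (simp add: B_def)
qed

text \<open>The law of the \<open>n\<close>-th step of the chain started at \<open>u\<close>.\<close>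

fun subst_iter :: "('a \<Rightarrow> 'a list pmf) \<Rightarrow> nat \<Rightarrow> 'a list \<Rightarrow> 'a list pmf" where
  "subst_iter P 0 u = return_pmf u"
| "subst_iter P (Suc n) u = bind_pmf (subst_iter P n u) (subst_kernel P)"

text \<open>\<open>X\<close> is a Markov chain on the probability space \<open>M\<close> with the kernel of \<open>P\<close> and initial
  word \<open>u\<close>. The Markov property is written without division, so that histories of probability
  zero need no special treatment.\<close>

definition subst_chain ::
    "('a \<Rightarrow> 'a list pmf) \<Rightarrow> 'a list \<Rightarrow> 'w measure \<Rightarrow> (nat \<Rightarrow> 'w \<Rightarrow> 'a list) \<Rightarrow> bool" where
  "subst_chain P u M X \<longleftrightarrow>
     prob_space M \<and>
     (\<forall>n. X n \<in> measurable M (count_space UNIV)) \<and>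
     (AE \<omega> in M. X 0 \<omega> = u) \<and>
     (\<forall>n w. measure M {\<omega> \<in> space M. \<forall>i\<le>Suc n. X i \<omega> = w i} =
            measure M {\<omega> \<in> space M. \<forall>i\<le>n. X i \<omega> = w i} * pmf (subst_kernel P (w n)) (w (Suc n)))"

section \<open>Matrices over a finite index set\<close>

text \<open>The induced matrix is indexed by a set of words depending on the substitution, so
  matrices and vectors are functions, of which only the values on an explicit finite index set
  \<open>S\<close> matter.\<close>

fun mat_pow_on :: "'i set \<Rightarrow> ('i \<Rightarrow> 'i \<Rightarrow> real) \<Rightarrow> nat \<Rightarrow> 'i \<Rightarrow> 'i \<Rightarrow> real" where
  "mat_pow_on S A 0 i j = (if i = j then 1 else 0)"
| "mat_pow_on S A (Suc k) i j = (\<Sum>m\<in>S. A i m * mat_pow_on S A k m j)"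

definition primitive_matrix :: "'i set \<Rightarrow> ('i \<Rightarrow> 'i \<Rightarrow> real) \<Rightarrow> bool" where
  "primitive_matrix S A \<longleftrightarrow>
     (\<forall>i\<in>S. \<forall>j\<in>S. 0 \<le> A i j) \<and> (\<exists>k\<ge>1. \<forall>i\<in>S. \<forall>j\<in>S. 0 < mat_pow_on S A k i j)"

definition eigenvalue_on :: "'i set \<Rightarrow> ('i \<Rightarrow> 'i \<Rightarrow> real) \<Rightarrow> complex \<Rightarrow> bool" where
  "eigenvalue_on S A c \<longleftrightarrow>
     (\<exists>x. (\<exists>i\<in>S. x i \<noteq> 0) \<and> (\<forall>i\<in>S. (\<Sum>j\<in>S. complex_of_real (A i j) * x j) = c * x i))"

text \<open>For a primitive matrix the Perron--Frobenius eigenvalue is the spectral radius.\<close>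

definition pf_eigenvalue :: "'i set \<Rightarrow> ('i \<Rightarrow> 'i \<Rightarrow> real) \<Rightarrow> real" where
  "pf_eigenvalue S A = Sup (cmod ` {c. eigenvalue_on S A c})"

text \<open>The norm fixes the eigenvector only up to sign; the positive one is meant. Setting it to
  zero outside \<open>S\<close> makes the function unique.\<close>

definition pf_right_eigenvector :: "'i set \<Rightarrow> ('i \<Rightarrow> 'i \<Rightarrow> real) \<Rightarrow> 'i \<Rightarrow> real" where
  "pf_right_eigenvector S A = (THE R.
     (\<forall>i\<in>S. (\<Sum>j\<in>S. A i j * R j) = pf_eigenvalue S A * R i) \<and>
     (\<forall>i\<in>S. 0 < R i) \<and> (\<Sum>i\<in>S. \<bar>R i\<bar>) = 1 \<and> (\<forall>i. i \<notin> S \<longrightarrow> R i = 0))"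

section \<open>Primitivity, legal words and the induced matrix\<close>

definition subst_matrix :: "('a \<Rightarrow> 'a list pmf) \<Rightarrow> 'a \<Rightarrow> 'a \<Rightarrow> real" where
  "subst_matrix P a b = measure_pmf.expectation (P b) (\<lambda>w. real (occ [a] w))"

definition primitive_substitution :: "('a::finite \<Rightarrow> 'a list pmf) \<Rightarrow> bool" where
  "primitive_substitution P \<longleftrightarrow> primitive_matrix UNIV (subst_matrix P)"

definition expanding_substitution :: "('a::finite \<Rightarrow> 'a list pmf) \<Rightarrow> bool" where
  "expanding_substitution P \<longleftrightarrow> (\<exists>a. measure_pmf.prob (P a) {w. 1 < length w} > 0)"

definition legal_words :: "('a \<Rightarrow> 'a list pmf) \<Rightarrow> 'a list set" where
  "legal_words P =
     {u. u \<noteq> [] \<and> (\<exists>n a v. pmf (subst_iter P n [a]) v > 0 \<and> 1 \<le> occ u v)}"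

definition legal_words_of_length :: "('a \<Rightarrow> 'a list pmf) \<Rightarrow> nat \<Rightarrow> 'a list set" where
  "legal_words_of_length P l = {u \<in> legal_words P. length u = l}"

text \<open>The law of the random word \<open>\<vartheta>\<^sub>l(u)\<close>, whose letters are words of length \<open>l\<close>: the windows of
  the image of \<open>u\<close> that start inside the image of the first letter of \<open>u\<close>.\<close>

definition induced_law :: "('a \<Rightarrow> 'a list pmf) \<Rightarrow> nat \<Rightarrow> 'a list \<Rightarrow> 'a list list pmf" where
  "induced_law P l u =
     map_pmf (\<lambda>ws. map (\<lambda>k. take l (drop k (concat ws))) [0..<length (hd ws)]) (subst_blocks P u)"

definition induced_matrix :: "('a \<Rightarrow> 'a list pmf) \<Rightarrow> nat \<Rightarrow> 'a list \<Rightarrow> 'a list \<Rightarrow> real" where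
  "induced_matrix P l u v = measure_pmf.expectation (induced_law P l v) (\<lambda>w. real (occ [u] w))"

end

theory Submission
  imports Defs
begin

text \<open>Write \<open>L n\<close> for the length of the \<open>n\<close>-th word of the chain and \<open>F n u\<close> for its number of occurrences of
  the legal word \<open>u\<close>. Given the \<open>n\<close>-th word, \<open>F (n + 1) - A (F n)\<close> with \<open>A\<close> the induced matrix has second
  moment \<open>O(L n)\<close>, because images of letters at distance at least \<open>l\<close> contribute independently. Since the
  expectation of \<open>1 / L n\<close> decays exponentially, the sum over \<open>n\<close> of the expectations of
  \<open>(F (n + 1) - A (F n))\<^sup>2 / (L n)\<^sup>2\<close> is finite, so \<open>F (n + 1) = A (F n) + o(L n)\<close> almost surely. The rest is
  deterministic: a primitive matrix contracts directions towards its Perron--Frobenius eigenvector, and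
  this contraction absorbs the errors.\<close>

section \<open>Perron--Frobenius theory of primitive matrices\<close>

text \<open>Frequencies depend only on the direction of the vector \<open>F n\<close>, so every
  error has to be small only relative to \<open>L n\<close>; this is why a second-moment bound
  linear in \<open>L n\<close> suffices. The decay of the expectation of \<open>1 / L n\<close>
  comes from independence: the descendants of a word of m letters are m independent populations, and
  Cauchy--Schwarz turns this into submultiplicativity in n, while expansion makes one factor smaller
  than 1. The obstacle in the variance bound is overlap: a window starting in one image also reads
  the images of the next l - 1 letters, and near the end of the word windows are cut off. Both
  effects cost only a bounded amount per letter. The normalisation of the limit is recovered from
  the fact that a long legal word x has \<open>length x + 1 - l\<close> windows of length l, all of
  them legal. As \<open>pf_right_eigenvector\<close> is a definite description involving the
  spectral radius, existence, uniqueness and maximality of the eigenpair all have to be available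
  before the limit can be named.\<close>

lemma mat_pow_nonneg:
  assumes "\<And>i j. i \<in> S \<Longrightarrow> j \<in> S \<Longrightarrow> 0 \<le> A i j" "i \<in> S" "j \<in> S"
  shows "0 \<le> mat_pow_on S A k i j"
  using assms(2) by (induction k arbitrary: i) (auto intro!: sum_nonneg mult_nonneg_nonneg assms)

lemma mat_pow_apply:
  assumes "finite S" "i \<in> S"
  shows "(\<Sum>j\<in>S. mat_pow_on S A (Suc k) i j * x j)
       = (\<Sum>m\<in>S. A i m * (\<Sum>j\<in>S. mat_pow_on S A k m j * x j))"
proof -
  have "(\<Sum>j\<in>S. mat_pow_on S A (Suc k) i j * x j)
      = (\<Sum>j\<in>S. \<Sum>m\<in>S. A i m * (mat_pow_on S A k m j * x j))"
    by (simp add: sum_distrib_right mult.assoc)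
  also have "\<dots> = (\<Sum>m\<in>S. \<Sum>j\<in>S. A i m * (mat_pow_on S A k m j * x j))"
    by (rule sum.swap)
  finally show ?thesis by (simp add: sum_distrib_left)
qed

lemma mat_pow_0_apply:
  assumes "finite S" "i \<in> S"
  shows "(\<Sum>j\<in>S. mat_pow_on S A 0 i j * x j) = x i"
  using assms by (simp add: if_distrib[of "\<lambda>c. c * _"] cong: if_cong)

text \<open>The recursion peels off factors on the left. Peeling on the right as well makes
  \<open>A\<close> commute with its powers, as the Collatz--Wielandt argument requires.\<close>

lemma mat_pow_Suc_right:
  assumes "finite S" "i \<in> S" "j \<in> S"
  shows "mat_pow_on S A (Suc k) i j = (\<Sum>m\<in>S. mat_pow_on S A k i m * A m j)"
  using assms(2)
proof (induction k arbitrary: i)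
  case 0
  then show ?case
    using assms by (simp add: if_distrib[of "\<lambda>c. c * _"] if_distrib[of "\<lambda>c. _ * c"] cong: if_cong)
next
  case (Suc k)
  have "mat_pow_on S A (Suc (Suc k)) i j
      = (\<Sum>m\<in>S. A i m * (\<Sum>n\<in>S. mat_pow_on S A k m n * A n j))"
    using Suc by simp
  also have "\<dots> = (\<Sum>n\<in>S. mat_pow_on S A (Suc k) i n * A n j)"
    by (rule mat_pow_apply[OF assms(1) Suc.prems, symmetric])
  finally show ?case .
qed

lemma mat_pow_eigenvector:
  assumes "finite S" "\<And>i. i \<in> S \<Longrightarrow> (\<Sum>j\<in>S. A i j * x j) = r * x i" "i \<in> S"
  shows "(\<Sum>j\<in>S. mat_pow_on S A k i j * x j) = r ^ k * x i"
  using assms(3)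
proof (induction k arbitrary: i)
  case 0
  then show ?case using mat_pow_0_apply[OF assms(1)] by simp
next
  case (Suc k)
  have "(\<Sum>j\<in>S. mat_pow_on S A (Suc k) i j * x j) = (\<Sum>m\<in>S. r ^ k * (A i m * x m))"
    unfolding mat_pow_apply[OF assms(1) Suc.prems]
    by (intro sum.cong refl) (simp add: Suc.IH)
  also have "\<dots> = r ^ Suc k * x i"
    using assms(2)[OF Suc.prems] by (simp add: sum_distrib_left[symmetric])
  finally show ?case .
qed

section \<open>Uniqueness, maximality and existence of the positive eigenpair\<close>

lemma sum_mult_pos:
  fixes c x :: "'i \<Rightarrow> real"
  assumes "finite S" "\<And>j. j \<in> S \<Longrightarrow> 0 < c j" "\<And>j. j \<in> S \<Longrightarrow> 0 \<le> x j" "i \<in> S" "x i \<noteq> 0"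
  shows "0 < (\<Sum>j\<in>S. c j * x j)"
proof -
  have "0 < c i * x i" using assms(2-5) by (simp add: less_le)
  also have "\<dots> \<le> (\<Sum>j\<in>S. c j * x j)"
    using assms by (intro member_le_sum mult_nonneg_nonneg) (auto intro: less_imp_le)
  finally show ?thesis .
qed

text \<open>Subtract from \<open>R'\<close> the largest multiple of \<open>R\<close> that leaves a
  nonnegative vector. The difference is again an eigenvector and vanishes at some index, so a
  strictly positive power of \<open>A\<close> forces it to vanish everywhere; equal sums make the
  multiple 1.\<close>

lemma pf_unique:
  fixes R R' :: "'i \<Rightarrow> real"
  assumes "finite S" "S \<noteq> {}" and pos: "\<And>i j. i \<in> S \<Longrightarrow> j \<in> S \<Longrightarrow> 0 < mat_pow_on S A k i j"
    and eig: "\<And>i. i \<in> S \<Longrightarrow> (\<Sum>j\<in>S. A i j * R j) = r * R i"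
    and eig': "\<And>i. i \<in> S \<Longrightarrow> (\<Sum>j\<in>S. A i j * R' j) = r * R' i"
    and R: "\<And>i. i \<in> S \<Longrightarrow> 0 < R i"
    and norm: "(\<Sum>i\<in>S. R i) = (\<Sum>i\<in>S. R' i)"
    and i: "i \<in> S"
  shows "R' i = R i"
proof -
  define t where "t = Min ((\<lambda>i. R' i / R i) ` S)"
  define x where "x = (\<lambda>i. R' i - t * R i)"
  have x0: "0 \<le> x j" if "j \<in> S" for j
  proof -
    have "t \<le> R' j / R j" unfolding t_def using assms(1) that by (intro Min_le) auto
    then show ?thesis using R[OF that] by (simp add: x_def field_simps)
  qed
  have "t \<in> (\<lambda>i. R' i / R i) ` S" unfolding t_def using assms(1,2) by (intro Min_in) auto
  then obtain m where m: "m \<in> S" "t = R' m / R m" by auto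
  have xm: "x m = 0" using R[OF m(1)] by (simp add: x_def m(2))
  have "(\<Sum>j\<in>S. A i j * x j) = r * x i" if "i \<in> S" for i
  proof -
    have "(\<Sum>j\<in>S. A i j * x j) = (\<Sum>j\<in>S. A i j * R' j) - t * (\<Sum>j\<in>S. A i j * R j)"
      by (simp add: x_def algebra_simps sum_subtractf sum_distrib_left)
    then show ?thesis using eig[OF that] eig'[OF that] by (simp add: x_def algebra_simps)
  qed
  from mat_pow_eigenvector[OF assms(1) this m(1), of k]
  have z: "(\<Sum>j\<in>S. mat_pow_on S A k m j * x j) = 0" by (simp add: xm)
  have "x j = 0" if "j \<in> S" for j
    using sum_mult_pos[where c = "mat_pow_on S A k m" and x = x, OF assms(1) pos[OF m(1)] x0 that] z by force
  then have R': "R' j = t * R j" if "j \<in> S" for j using that by (simp add: x_def)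
  have "(\<Sum>i\<in>S. R' i) = t * (\<Sum>i\<in>S. R i)"
    unfolding sum_distrib_left by (intro sum.cong refl R')
  then have "(\<Sum>i\<in>S. R i) = t * (\<Sum>i\<in>S. R i)" using norm by simp
  moreover have "(\<Sum>i\<in>S. R i) > 0" using assms(1,2) R by (intro sum_pos) auto
  ultimately show ?thesis using R'[OF i] by simp
qed

text \<open>A positive eigenvector dominates all others: at an index where
  \<open>cmod (x i) / R i\<close> is maximal, the triangle inequality in the eigenvalue equation for
  \<open>x\<close> gives \<open>cmod c \<le> r\<close>.\<close>

lemma pf_eigenvalue_eq:
  fixes R :: "'i \<Rightarrow> real"
  assumes "finite S" "S \<noteq> {}" and A: "\<And>i j. i \<in> S \<Longrightarrow> j \<in> S \<Longrightarrow> 0 \<le> A i j"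
    and eig: "\<And>i. i \<in> S \<Longrightarrow> (\<Sum>j\<in>S. A i j * R j) = r * R i"
    and R: "\<And>i. i \<in> S \<Longrightarrow> 0 < R i" and r: "0 \<le> r"
  shows "pf_eigenvalue S A = r"
  unfolding pf_eigenvalue_def
proof (rule cSup_eq_maximum)
  have "eigenvalue_on S A (complex_of_real r)"
    unfolding eigenvalue_on_def
  proof (intro exI conjI ballI)
    show "\<exists>i\<in>S. complex_of_real (R i) \<noteq> 0" using assms(2) R by fastforce
    fix i assume i: "i \<in> S"
    have "complex_of_real (\<Sum>j\<in>S. A i j * R j) = complex_of_real (r * R i)"
      by (simp only: eig[OF i])
    then show "(\<Sum>j\<in>S. complex_of_real (A i j) * complex_of_real (R j)) = complex_of_real r * complex_of_real (R i)"
      by simp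
  qed
  then show "r \<in> cmod ` {c. eigenvalue_on S A c}"
    using r by (force intro!: image_eqI[where x = "complex_of_real r"])
next
  fix y assume "y \<in> cmod ` {c. eigenvalue_on S A c}"
  then obtain c x where y: "y = cmod c" and x: "\<exists>i\<in>S. x i \<noteq> 0"
    and cx: "\<And>i. i \<in> S \<Longrightarrow> (\<Sum>j\<in>S. complex_of_real (A i j) * x j) = c * x i"
    unfolding eigenvalue_on_def by auto
  define t where "t = Max ((\<lambda>i. cmod (x i) / R i) ` S)"
  have t: "cmod (x j) \<le> t * R j" if "j \<in> S" for j
  proof -
    have "cmod (x j) / R j \<le> t" unfolding t_def using assms(1) that by (intro Max_ge) auto
    then show ?thesis using R[OF that] by (simp add: field_simps)
  qed
  have "t \<in> (\<lambda>i. cmod (x i) / R i) ` S" unfolding t_def using assms(1,2) by (intro Max_in) auto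
  then obtain m where m: "m \<in> S" "t = cmod (x m) / R m" by auto
  have xm: "cmod (x m) = t * R m" using R[OF m(1)] by (simp add: m(2))
  have tpos: "0 < t"
  proof -
    from x obtain j where "j \<in> S" "0 < cmod (x j)" by auto
    with t[of j] R[of j] have "0 < t * R j" by linarith
    with R[OF \<open>j \<in> S\<close>] show ?thesis by (simp add: zero_less_mult_iff)
  qed
  have "cmod c * cmod (x m) \<le> (\<Sum>j\<in>S. A m j * cmod (x j))"
    using norm_sum[of "\<lambda>j. complex_of_real (A m j) * x j" S] A[OF m(1)]
    by (simp add: cx[OF m(1)] norm_mult cong: sum.cong)
  also have "\<dots> \<le> (\<Sum>j\<in>S. A m j * (t * R j))"
    by (intro sum_mono mult_left_mono t A m(1))
  also have "\<dots> = t * (\<Sum>j\<in>S. A m j * R j)"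
    by (simp add: sum_distrib_left algebra_simps)
  also have "\<dots> = r * cmod (x m)" by (simp add: eig[OF m(1)] xm)
  finally show "y \<le> r" using tpos R[OF m(1)] by (simp add: y xm mult_le_cancel_right zero_less_mult_iff)
qed

text \<open>Bolzano--Weierstrass for vectors given as functions on a finite index set, by thinning
  out the sequence one coordinate at a time.\<close>

lemma convergent_subseq_on:
  fixes f :: "nat \<Rightarrow> 'i \<Rightarrow> real"
  assumes "finite S" "\<And>n i. i \<in> S \<Longrightarrow> \<bar>f n i\<bar> \<le> B"
  shows "\<exists>r g. strict_mono (r :: nat \<Rightarrow> nat) \<and> (\<forall>i\<in>S. (\<lambda>n. f (r n) i) \<longlonglongrightarrow> g i)"
  using assms
proof (induction S rule: finite_induct)
  case empty
  then show ?case by (auto intro!: exI[of _ id] strict_monoI)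
next
  case (insert a S)
  then obtain r g where r: "strict_mono (r :: nat \<Rightarrow> nat)" "\<forall>i\<in>S. (\<lambda>n. f (r n) i) \<longlonglongrightarrow> g i"
    by auto
  have "bounded (range (\<lambda>n. f (r n) a))"
    using insert.prems by (auto simp: bounded_iff)
  then obtain l q where q: "strict_mono (q :: nat \<Rightarrow> nat)" "((\<lambda>n. f (r n) a) \<circ> q) \<longlonglongrightarrow> l"
    using bounded_imp_convergent_subsequence by blast
  have "(\<lambda>n. f (r (q n)) i) \<longlonglongrightarrow> (g(a := l)) i" if "i \<in> insert a S" for i
    using q(2) LIMSEQ_subseq_LIMSEQ[OF bspec[OF r(2)] q(1), of i] that insert.hyps
    by (auto simp: o_def)
  moreover have "strict_mono (r \<circ> q)" by (rule strict_mono_o[OF r(1) q(1)])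
  ultimately show ?case by (intro exI[of _ "r \<circ> q"] exI[of _ "g(a := l)"]) (auto simp: o_def)
qed

text \<open>Collatz--Wielandt: a nonnegative normalised \<open>x\<close> with \<open>A x \<ge> t x\<close> and \<open>t\<close> maximal is an
  eigenvector, as otherwise applying the positive power of \<open>A\<close> makes the inequality strict.\<close>

lemma pf_existence:
  fixes A :: "'i \<Rightarrow> 'i \<Rightarrow> real"
  assumes "finite S" "S \<noteq> {}" "primitive_matrix S A"
  shows "\<exists>R r. 0 < r \<and> (\<forall>i\<in>S. (\<Sum>j\<in>S. A i j * R j) = r * R i) \<and> (\<forall>i\<in>S. 0 < R i) \<and> (\<Sum>i\<in>S. R i) = 1"
proof -
  obtain k where k: "k \<ge> 1" and A: "\<And>i j. i \<in> S \<Longrightarrow> j \<in> S \<Longrightarrow> 0 \<le> A i j"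
    and pos: "\<And>i j. i \<in> S \<Longrightarrow> j \<in> S \<Longrightarrow> 0 < mat_pow_on S A k i j"
    using assms(3) unfolding primitive_matrix_def by blast
  define good where "good t x \<longleftrightarrow> (\<forall>i\<in>S. 0 \<le> x i) \<and> (\<Sum>i\<in>S. x i) = 1 \<and>
    (\<forall>i\<in>S. t * x i \<le> (\<Sum>j\<in>S. A i j * x j))" for t and x :: "'i \<Rightarrow> real"
  define T where "T = {t. \<exists>x. good t x}"
  have x1: "x i \<le> 1" if "good t x" "i \<in> S" for t x i
  proof -
    have "x i \<le> (\<Sum>i\<in>S. x i)" using that assms(1) by (intro member_le_sum) (auto simp: good_def)
    then show ?thesis using that by (simp add: good_def)
  qed
  \<comment> \<open>The coordinates of a normalised \<open>x\<close> are at most 1, so adding up the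
    inequalities bounds t by the sum of all entries.\<close>
  have bdd: "bdd_above T"
  proof (rule bdd_aboveI)
    fix t assume "t \<in> T"
    then obtain x where x: "good t x" by (auto simp: T_def)
    have "t = (\<Sum>i\<in>S. t * x i)" using x by (simp add: good_def sum_distrib_left[symmetric])
    also have "\<dots> \<le> (\<Sum>i\<in>S. \<Sum>j\<in>S. A i j * x j)" using x by (intro sum_mono) (auto simp: good_def)
    also have "\<dots> \<le> (\<Sum>i\<in>S. \<Sum>j\<in>S. A i j * 1)"
      using A x1[OF x] by (intro sum_mono mult_left_mono) auto
    finally show "t \<le> (\<Sum>i\<in>S. \<Sum>j\<in>S. A i j)" by simp
  qed
  have zero: "0 \<in> T"
  proof -
    have "good 0 (\<lambda>_. 1 / real (card S))"
      using assms(1,2) A by (auto simp: good_def intro!: sum_nonneg)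
    then show ?thesis by (auto simp: T_def)
  qed
  define r where "r = Sup T"
  have le_r: "t \<le> r" if "good t x" for t x
    unfolding r_def using that by (intro cSup_upper bdd) (auto simp: T_def)
  have r0: "0 \<le> r" unfolding r_def by (intro cSup_upper bdd zero)
  \<comment> \<open>Nearly optimal vectors, from which compactness extracts one attaining the
    supremum.\<close>
  have "\<exists>x. good (r - 1 / real (Suc n)) x" for n
  proof -
    have "r - 1 / real (Suc n) < Sup T" by (simp add: r_def)
    then obtain t where t: "t \<in> T" "r - 1 / real (Suc n) < t"
      using less_cSup_iff[of T] zero bdd by auto
    then obtain x where x: "good t x" by (auto simp: T_def)
    have "(r - 1 / real (Suc n)) * x i \<le> t * x i" if "i \<in> S" for i
      using x t(2) that by (intro mult_right_mono) (auto simp: good_def)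
    then have "good (r - 1 / real (Suc n)) x" using x unfolding good_def by (meson order_trans)
    then show ?thesis by blast
  qed
  then obtain X where X: "\<And>n. good (r - 1 / real (Suc n)) (X n)" by metis
  have "\<bar>X n i\<bar> \<le> 1" if "i \<in> S" for n i
    using X[of n] x1[OF X that, of n] that by (auto simp: good_def)
  with convergent_subseq_on[OF assms(1), of X 1]
  obtain q x where q: "strict_mono (q :: nat \<Rightarrow> nat)" and lim: "\<And>i. i \<in> S \<Longrightarrow> (\<lambda>n. X (q n) i) \<longlonglongrightarrow> x i"
    by blast
  have lr: "(\<lambda>n. r - 1 / real (Suc (q n))) \<longlonglongrightarrow> r"
    using LIMSEQ_subseq_LIMSEQ[OF LIMSEQ_inverse_real_of_nat_add_minus[of r] q]
    by (simp add: o_def inverse_eq_divide)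
  have gx: "good r x"
    unfolding good_def
  proof (intro conjI ballI)
    fix i assume i: "i \<in> S"
    show "0 \<le> x i" using X i by (intro LIMSEQ_le_const[OF lim]) (auto simp: good_def)
    show "r * x i \<le> (\<Sum>j\<in>S. A i j * x j)"
    proof (rule LIMSEQ_le)
      show "(\<lambda>n. (r - 1 / real (Suc (q n))) * X (q n) i) \<longlonglongrightarrow> r * x i"
        by (intro tendsto_mult lr lim i)
      show "(\<lambda>n. \<Sum>j\<in>S. A i j * X (q n) j) \<longlonglongrightarrow> (\<Sum>j\<in>S. A i j * x j)"
        by (intro tendsto_sum tendsto_mult tendsto_const lim)
      show "\<exists>N. \<forall>n\<ge>N. (r - 1 / real (Suc (q n))) * X (q n) i \<le> (\<Sum>j\<in>S. A i j * X (q n) j)"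
        using X i unfolding good_def by blast
    qed
  next
    have "(\<lambda>n. \<Sum>i\<in>S. X (q n) i) \<longlonglongrightarrow> (\<Sum>i\<in>S. x i)" by (intro tendsto_sum lim)
    moreover have "(\<Sum>i\<in>S. X n i) = 1" for n using X by (simp add: good_def)
    ultimately show "(\<Sum>i\<in>S. x i) = 1" by (simp add: LIMSEQ_const_iff)
  qed
  define B where "B z i = (\<Sum>j\<in>S. mat_pow_on S A k i j * z j)" for z i
  have xne: "\<exists>i\<in>S. x i \<noteq> 0"
  proof (rule ccontr)
    assume "\<not> ?thesis"
    then have "(\<Sum>i\<in>S. x i) = 0" by simp
    with gx show False by (simp add: good_def)
  qed
  have x0: "0 \<le> x i" if "i \<in> S" for i using gx that by (simp add: good_def)
  have Bpos: "0 < B x i" if "i \<in> S" for i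
    unfolding B_def using xne sum_mult_pos[where c = "mat_pow_on S A k i" and x = x, OF assms(1) pos[OF that] x0] by auto
  have eig: "(\<Sum>j\<in>S. A i j * x j) = r * x i" if i: "i \<in> S" for i
  proof (rule ccontr)
    assume ne: "(\<Sum>j\<in>S. A i j * x j) \<noteq> r * x i"
    \<comment> \<open>The defect is nonnegative and nonzero at i, so \<open>B\<close>, the positive
      power of \<open>A\<close>, makes it positive in every coordinate.\<close>
    define d where "d i = (\<Sum>j\<in>S. A i j * x j) - r * x i" for i
    have d0: "0 \<le> d j" if "j \<in> S" for j using gx that by (simp add: good_def d_def)
    have Bd: "0 < B d j" if "j \<in> S" for j
      unfolding B_def using sum_mult_pos[where c = "mat_pow_on S A k j" and x = d, OF assms(1) pos[OF that] d0 i] ne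
      by (simp add: d_def)
    have Bd_eq: "B d j = (\<Sum>m\<in>S. A j m * B x m) - r * B x j" if j: "j \<in> S" for j
    proof -
      have "(\<Sum>m\<in>S. A j m * B x m) = (\<Sum>m\<in>S. mat_pow_on S A (Suc k) j m * x m)"
        unfolding B_def by (rule mat_pow_apply[OF assms(1) j, symmetric])
      also have "\<dots> = (\<Sum>m\<in>S. \<Sum>n\<in>S. mat_pow_on S A k j n * A n m * x m)"
        by (intro sum.cong refl) (simp only: mat_pow_Suc_right[OF assms(1) j] sum_distrib_right)
      also have "\<dots> = (\<Sum>n\<in>S. mat_pow_on S A k j n * (\<Sum>m\<in>S. A n m * x m))"
        by (subst sum.swap) (simp add: sum_distrib_left mult.assoc)
      finally show ?thesis
        by (simp add: B_def d_def right_diff_distrib sum_subtractf sum_distrib_left mult_ac)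
    qed
    \<comment> \<open>The smallest relative gain: the normalised \<open>B x\<close> satisfies the
      inequality with \<open>r + e\<close>, against the maximality of \<open>r\<close>.\<close>
    define e where "e = Min ((\<lambda>j. B d j / B x j) ` S)"
    have "e \<in> (\<lambda>j. B d j / B x j) ` S" unfolding e_def using assms(1,2) by (intro Min_in) auto
    then have e: "0 < e" using Bd Bpos by auto
    have e_le: "e * B x j \<le> B d j" if "j \<in> S" for j
    proof -
      have "e \<le> B d j / B x j" unfolding e_def using assms(1) that by (intro Min_le) auto
      then show ?thesis using Bpos[OF that] by (simp add: field_simps)
    qed
    define c where "c = (\<Sum>j\<in>S. B x j)"
    have c: "0 < c" unfolding c_def using assms(1,2) Bpos by (intro sum_pos) auto
    have "good (r + e) (\<lambda>j. B x j / c)"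
      unfolding good_def
    proof (intro conjI ballI)
      fix j assume j: "j \<in> S"
      show "0 \<le> B x j / c" using Bpos[OF j] c by simp
      have "(r + e) * B x j \<le> (\<Sum>m\<in>S. A j m * B x m)"
        using e_le[OF j] Bd_eq[OF j] by (simp add: algebra_simps)
      then have "(r + e) * B x j / c \<le> (\<Sum>m\<in>S. A j m * B x m) / c"
        using c by (intro divide_right_mono) auto
      then show "(r + e) * (B x j / c) \<le> (\<Sum>m\<in>S. A j m * (B x m / c))"
        by (simp add: sum_divide_distrib)
    next
      show "(\<Sum>j\<in>S. B x j / c) = 1" using c by (simp add: c_def sum_divide_distrib[symmetric])
    qed
    from le_r[OF this] e show False by simp
  qed
  have rx: "B x i = r ^ k * x i" if "i \<in> S" for i
    unfolding B_def by (rule mat_pow_eigenvector[OF assms(1) eig that])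
  have xpos: "0 < x i" if "i \<in> S" for i
    using Bpos[OF that] x0[OF that] rx[OF that] by (cases "x i = 0") auto
  have "0 < r"
  proof -
    from assms(2) obtain i where "i \<in> S" by auto
    with Bpos rx k r0 show ?thesis by (cases "r = 0") (auto simp: power_0_left)
  qed
  then show ?thesis using eig xpos gx by (auto simp: good_def)
qed

text \<open>Once the spectral radius is known to be \<open>r\<close>, a competitor in the definite
  description solves the same eigenvalue equation and, being positive, has coordinate sum 1, so
  \<open>pf_unique\<close> applies.\<close>

lemma pf_right_eigenvector_eq:
  fixes R :: "'i \<Rightarrow> real"
  assumes "finite S" "S \<noteq> {}" "primitive_matrix S A" "0 \<le> r"
    and eig: "\<And>i. i \<in> S \<Longrightarrow> (\<Sum>j\<in>S. A i j * R j) = r * R i"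
    and R: "\<And>i. i \<in> S \<Longrightarrow> 0 < R i" and norm: "(\<Sum>i\<in>S. R i) = 1" and i: "i \<in> S"
  shows "pf_right_eigenvector S A i = R i"
proof -
  obtain k where k: "k \<ge> 1" and A: "\<And>i j. i \<in> S \<Longrightarrow> j \<in> S \<Longrightarrow> 0 \<le> A i j"
    and pos: "\<And>i j. i \<in> S \<Longrightarrow> j \<in> S \<Longrightarrow> 0 < mat_pow_on S A k i j"
    using assms(3) unfolding primitive_matrix_def by blast
  have pf: "pf_eigenvalue S A = r"
    by (rule pf_eigenvalue_eq[OF assms(1,2) A eig R assms(4)])
  have "pf_right_eigenvector S A = (\<lambda>i. if i \<in> S then R i else 0)"
    unfolding pf_right_eigenvector_def pf
  proof (rule the_equality, intro conjI ballI allI impI)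
    fix i assume "i \<in> S"
    then show "(\<Sum>j\<in>S. A i j * (if j \<in> S then R j else 0)) = r * (if i \<in> S then R i else 0)"
      using eig by simp
  next
    have "(\<Sum>i\<in>S. \<bar>R i\<bar>) = (\<Sum>i\<in>S. R i)" using R by (intro sum.cong) (auto simp: less_imp_le)
    then show "(\<Sum>i\<in>S. \<bar>if i \<in> S then R i else 0\<bar>) = 1" using norm by simp
  next
    fix R' assume R': "(\<forall>i\<in>S. (\<Sum>j\<in>S. A i j * R' j) = r * R' i) \<and>
      (\<forall>i\<in>S. 0 < R' i) \<and> (\<Sum>i\<in>S. \<bar>R' i\<bar>) = 1 \<and> (\<forall>i. i \<notin> S \<longrightarrow> R' i = 0)"
    have "(\<Sum>i\<in>S. \<bar>R' i\<bar>) = (\<Sum>i\<in>S. R' i)" using R' by (intro sum.cong) (auto simp: less_imp_le)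
    then have n: "(\<Sum>i\<in>S. R i) = (\<Sum>i\<in>S. R' i)" using norm R' by simp
    have "R' i = R i" if "i \<in> S" for i
      by (rule pf_unique[OF assms(1,2) pos eig _ R n that]) (use R' in auto)
    then show "R' = (\<lambda>i. if i \<in> S then R i else 0)" using R' by (auto simp: fun_eq_iff)
  qed (use R in auto)
  then show ?thesis using i by simp
qed

section \<open>Power iteration with vanishing relative errors\<close>

text \<open>For large n the error is below \<open>\<delta> * (\<epsilon> / 2)\<close>. The affine
  map with this error has fixed point \<open>\<epsilon> / 2\<close>, so the excess of
  \<open>d\<close> over \<open>\<epsilon> / 2\<close> contracts by \<open>1 - \<delta>\<close> every
  \<open>k\<close> steps.\<close>

lemma contraction_tendsto_0:
  fixes d e :: "nat \<Rightarrow> real"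
  assumes d: "\<And>n. d n \<le> 1" "\<And>n. 0 \<le> d n" and \<delta>: "0 < \<delta>" "\<delta> \<le> 1"
    and step: "eventually (\<lambda>n. d (n + k) \<le> (1 - \<delta>) * d n + e n) sequentially"
    and e: "e \<longlonglongrightarrow> 0"
  shows "d \<longlonglongrightarrow> 0"
proof (rule LIMSEQ_I)
  fix \<epsilon> :: real assume \<epsilon>: "0 < \<epsilon>"
  have "eventually (\<lambda>n. e n < \<delta> * (\<epsilon> / 2)) sequentially"
    using \<delta>(1) \<epsilon> by (intro order_tendstoD(2)[OF e]) auto
  with step have "eventually (\<lambda>n. d (n + k) - \<epsilon> / 2 \<le> (1 - \<delta>) * (d n - \<epsilon> / 2)) sequentially"
    by eventually_elim (simp add: left_diff_distrib right_diff_distrib diff_divide_distrib)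
  then obtain N where N: "\<And>n. n \<ge> N \<Longrightarrow> d (n + k) - \<epsilon> / 2 \<le> (1 - \<delta>) * (d n - \<epsilon> / 2)"
    by (auto simp: eventually_sequentially)
  \<comment> \<open>The bound is uniform in the starting point n because \<open>d n \<le> 1\<close>;
    this handles all residue classes modulo \<open>k\<close> at once.\<close>
  have iter: "d (n + j * k) - \<epsilon> / 2 \<le> (1 - \<delta>) ^ j" if "n \<ge> N" for n j
  proof (induction j)
    case 0
    then show ?case using d(1)[of n] \<epsilon> by simp
  next
    case (Suc j)
    have "d (n + j * k + k) - \<epsilon> / 2 \<le> (1 - \<delta>) * (d (n + j * k) - \<epsilon> / 2)"
      using that by (intro N) auto
    also have "\<dots> \<le> (1 - \<delta>) * (1 - \<delta>) ^ j" using \<delta> by (intro mult_left_mono Suc) auto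
    finally show ?case by (simp add: algebra_simps)
  qed
  obtain J where J: "(1 - \<delta>) ^ J < \<epsilon> / 2"
    using real_arch_pow_inv[of "\<epsilon> / 2" "1 - \<delta>"] \<delta> \<epsilon> by auto
  have "d m < \<epsilon>" if "m \<ge> N + J * k" for m
  proof -
    have "m - J * k \<ge> N" "m - J * k + J * k = m" using that by linarith+
    with iter[of "m - J * k" J] J show ?thesis by simp
  qed
  then show "\<exists>no. \<forall>n\<ge>no. norm (d n - 0) < \<epsilon>" using d(2) by auto
qed

text \<open>Expanding m steps gives finitely many one-step errors multiplied by fixed matrices. The
  error made at time n + m is small relative to \<open>L (n + m)\<close>, and the growth bound
  \<open>K ^ m\<close> makes it small relative to \<open>L n\<close>.\<close>

lemma perturbed_iterates:
  fixes F :: "nat \<Rightarrow> 'i \<Rightarrow> real" and L :: "nat \<Rightarrow> real"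
  assumes "finite S" and L: "\<And>n. 0 < L n" "\<And>n. L (Suc n) \<le> K * L n"
    and err: "\<And>u. u \<in> S \<Longrightarrow> (\<lambda>n. (F (Suc n) u - (\<Sum>v\<in>S. A u v * F n v)) / L n) \<longlonglongrightarrow> 0"
    and u: "u \<in> S"
  shows "(\<lambda>n. (F (n + m) u - (\<Sum>v\<in>S. mat_pow_on S A m u v * F n v)) / L n) \<longlonglongrightarrow> 0"
  using u
proof (induction m arbitrary: u)
  case 0
  then show ?case using mat_pow_0_apply[OF assms(1) 0] by simp
next
  case (Suc m)
  have "0 < K * L 0" using L(1)[of 1] L(2)[of 0] by simp
  then have K: "0 \<le> K" using L(1)[of 0] by (simp add: zero_less_mult_iff)
  have LK: "L (n + m) \<le> K ^ m * L n" for n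
  proof (induction m)
    case (Suc m)
    have "L (n + Suc m) \<le> K * L (n + m)" using L(2) by simp
    also have "\<dots> \<le> K * (K ^ m * L n)" using K by (intro mult_left_mono Suc)
    finally show ?case by (simp add: mult_ac)
  qed simp
  define E where "E n = (F (Suc n) u - (\<Sum>v\<in>S. A u v * F n v)) / L n" for n
  have "(\<lambda>n. E (n + m)) \<longlonglongrightarrow> 0"
    unfolding E_def using LIMSEQ_ignore_initial_segment[OF err[OF Suc.prems]] .
  then have lim: "(\<lambda>n. \<bar>E (n + m)\<bar> * K ^ m) \<longlonglongrightarrow> 0"
    using tendsto_mult_left_zero tendsto_rabs_zero by blast
  have "(\<lambda>n. E (n + m) * (L (n + m) / L n)) \<longlonglongrightarrow> 0"
  proof (rule Lim_null_comparison[OF _ lim], rule always_eventually, rule allI)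
    fix n
    have "\<bar>L (n + m) / L n\<bar> \<le> K ^ m" using LK[of n] L(1) by (simp add: divide_le_eq less_imp_le abs_of_pos)
    then show "norm (E (n + m) * (L (n + m) / L n)) \<le> \<bar>E (n + m)\<bar> * K ^ m"
      by (simp only: real_norm_def abs_mult) (intro mult_left_mono abs_ge_zero)
  qed
  moreover have "(\<lambda>n. \<Sum>v\<in>S. A u v * ((F (n + m) v - (\<Sum>w\<in>S. mat_pow_on S A m v w * F n w)) / L n)) \<longlonglongrightarrow> 0"
    by (intro tendsto_null_sum tendsto_mult_right_zero Suc.IH)
  ultimately have "(\<lambda>n. E (n + m) * (L (n + m) / L n) +
      (\<Sum>v\<in>S. A u v * ((F (n + m) v - (\<Sum>w\<in>S. mat_pow_on S A m v w * F n w)) / L n))) \<longlonglongrightarrow> 0 + 0"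
    by (rule tendsto_add)
  moreover have "E (n + m) * (L (n + m) / L n) +
      (\<Sum>v\<in>S. A u v * ((F (n + m) v - (\<Sum>w\<in>S. mat_pow_on S A m v w * F n w)) / L n))
    = (F (n + Suc m) u - (\<Sum>v\<in>S. mat_pow_on S A (Suc m) u v * F n v)) / L n" for n
  proof -
    have "E (n + m) * (L (n + m) / L n) = (F (n + Suc m) u - (\<Sum>v\<in>S. A u v * F (n + m) v)) / L n"
      using L(1)[of "n + m"] by (simp add: E_def)
    moreover have "(\<Sum>v\<in>S. A u v * ((F (n + m) v - (\<Sum>w\<in>S. mat_pow_on S A m v w * F n w)) / L n))
      = ((\<Sum>v\<in>S. A u v * F (n + m) v) - (\<Sum>v\<in>S. A u v * (\<Sum>w\<in>S. mat_pow_on S A m v w * F n w))) / L n"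
      unfolding times_divide_eq_right sum_divide_distrib[symmetric]
      by (simp only: right_diff_distrib sum_subtractf)
    ultimately show ?thesis
      unfolding mat_pow_apply[OF assms(1) Suc.prems] by (simp add: diff_divide_distrib)
  qed
  ultimately show ?case by simp
qed

text \<open>A strictly positive power of \<open>A\<close> contracts the oscillation of \<open>F n / R\<close>: with \<open>lo n\<close> and
  \<open>hi n\<close> its extreme values, \<open>1 - lo n / hi n\<close> shrinks by a fixed factor up to a null sequence.\<close>

lemma perturbed_power_iteration:
  fixes F :: "nat \<Rightarrow> 'i \<Rightarrow> real" and L :: "nat \<Rightarrow> real"
  assumes S: "finite S" "S \<noteq> {}"
    and pos: "\<And>i j. i \<in> S \<Longrightarrow> j \<in> S \<Longrightarrow> 0 < mat_pow_on S A k i j"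
    and eig: "\<And>i. i \<in> S \<Longrightarrow> (\<Sum>j\<in>S. A i j * R j) = r * R i"
    and R: "\<And>i. i \<in> S \<Longrightarrow> 0 < R i" and norm: "(\<Sum>i\<in>S. R i) = 1" and r: "0 < r"
    and F: "\<And>n u. 0 \<le> F n u" and L: "\<And>n. 0 < L n" "\<And>n. L (Suc n) \<le> K * L n"
    and err: "\<And>u. u \<in> S \<Longrightarrow> (\<lambda>n. (F (Suc n) u - (\<Sum>v\<in>S. A u v * F n v)) / L n) \<longlonglongrightarrow> 0"
    and tot: "(\<lambda>n. (\<Sum>u\<in>S. F n u) / L n) \<longlonglongrightarrow> 1"
    and u: "u \<in> S"
  shows "(\<lambda>n. F n u / L n) \<longlonglongrightarrow> R u"
proof -
  define T where "T n = (\<Sum>u\<in>S. F n u)" for n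
  define hi where "hi n = Max ((\<lambda>u. F n u / R u) ` S)" for n
  define lo where "lo n = Min ((\<lambda>u. F n u / R u) ` S)" for n
  have lo_le: "lo n * R v \<le> F n v" and le_hi: "F n v \<le> hi n * R v" if v: "v \<in> S" for n v
  proof -
    have "lo n \<le> F n v / R v" "F n v / R v \<le> hi n"
      unfolding lo_def hi_def using S(1) v by (auto intro: Min_le Max_ge)
    then show "lo n * R v \<le> F n v" "F n v \<le> hi n * R v" using R[OF v] by (auto simp: field_simps)
  qed
  have lo_geI: "c \<le> lo n" if "\<And>v. v \<in> S \<Longrightarrow> c * R v \<le> F n v" for c n
    unfolding lo_def using S R that by (auto simp: pos_le_divide_eq)
  have hi_leI: "hi n \<le> c" if "\<And>v. v \<in> S \<Longrightarrow> F n v \<le> c * R v" for c n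
    unfolding hi_def using S R that by (auto simp: pos_divide_le_eq)
  have hi_at: "\<exists>v\<in>S. F n v = hi n * R v" for n
  proof -
    have "hi n \<in> (\<lambda>u. F n u / R u) ` S" unfolding hi_def using S by (intro Max_in) auto
    then obtain v where "v \<in> S" "hi n = F n v / R v" by auto
    then show ?thesis using R[of v] by (intro bexI[of _ v]) auto
  qed
  have lo0: "0 \<le> lo n" for n by (rule lo_geI) (simp add: F)
  have T_hi: "T n \<le> hi n" for n
  proof -
    have "T n \<le> (\<Sum>v\<in>S. hi n * R v)" unfolding T_def by (intro sum_mono le_hi)
    then show ?thesis by (simp add: sum_distrib_left[symmetric] norm)
  qed
  have T_lo: "lo n \<le> T n" for n
  proof -
    have "(\<Sum>v\<in>S. lo n * R v) \<le> T n" unfolding T_def by (intro sum_mono lo_le)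
    then show ?thesis by (simp add: sum_distrib_left[symmetric] norm)
  qed
  \<comment> \<open>If \<open>hi n = 0\<close>, division by zero makes this 1, which still respects
    the bounds below; for large n, \<open>hi n\<close> is positive.\<close>
  define d where "d n = 1 - lo n / hi n" for n
  have d1: "d n \<le> 1" for n
    using lo0[of n] T_lo[of n] T_hi[of n] by (simp add: d_def)
  have d0: "0 \<le> d n" for n
    using lo0[of n] T_lo[of n] T_hi[of n] by (cases "hi n = 0") (auto simp: d_def divide_le_eq_1)
  \<comment> \<open>Conjugating the power of \<open>A\<close> by the diagonal matrix of
    \<open>R\<close> and dividing by \<open>r ^ k\<close> gives a stochastic matrix;
    \<open>\<delta>\<close> is its smallest entry, the Doeblin constant, capped at 1.\<close>
  define \<delta> where "\<delta> = min 1 (Min ((\<lambda>(u, v). mat_pow_on S A k u v * R v / (r ^ k * R u)) ` (S \<times> S)))"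
  have \<delta>: "0 < \<delta>" "\<delta> \<le> 1"
    unfolding \<delta>_def using S pos R r by (auto simp: divide_simps)
  have \<delta>_le: "\<delta> * (r ^ k * R u) \<le> mat_pow_on S A k u v * R v" if "u \<in> S" "v \<in> S" for u v
  proof -
    have "Min ((\<lambda>(u, v). mat_pow_on S A k u v * R v / (r ^ k * R u)) ` (S \<times> S))
        \<le> mat_pow_on S A k u v * R v / (r ^ k * R u)"
      using S that by (intro Min_le) auto
    then have "\<delta> \<le> mat_pow_on S A k u v * R v / (r ^ k * R u)" by (auto simp: \<delta>_def)
    then show ?thesis using R[OF that(1)] r by (simp add: pos_le_divide_eq)
  qed
  define G where "G n u = (\<Sum>v\<in>S. mat_pow_on S A k u v * F n v)" for n u
  have eigk: "(\<Sum>v\<in>S. mat_pow_on S A k u v * R v) = r ^ k * R u" if "u \<in> S" for u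
    by (rule mat_pow_eigenvector[OF S(1) eig that])
  have G_hi: "G n u \<le> r ^ k * hi n * R u" if "u \<in> S" for n u
  proof -
    have "G n u \<le> (\<Sum>v\<in>S. mat_pow_on S A k u v * (hi n * R v))"
      unfolding G_def using that pos by (intro sum_mono mult_left_mono le_hi) (auto intro: less_imp_le)
    also have "\<dots> = hi n * (\<Sum>v\<in>S. mat_pow_on S A k u v * R v)"
      by (simp add: sum_distrib_left mult_ac)
    finally show ?thesis unfolding eigk[OF that] by (simp add: mult_ac)
  qed
  \<comment> \<open>Every new coordinate gives weight at least \<open>\<delta>\<close> to the index
    where the maximum \<open>hi n\<close> is attained, and all other old ratios are at least
    \<open>lo n\<close>.\<close>
  have G_lo: "r ^ k * (lo n + \<delta> * (hi n - lo n)) * R u \<le> G n u" if u: "u \<in> S" for n u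
  proof -
    obtain w where w: "w \<in> S" "F n w = hi n * R w" using hi_at by blast
    have "r ^ k * R u * (\<delta> * (hi n - lo n)) \<le> mat_pow_on S A k u w * R w * (hi n - lo n)"
      using mult_right_mono[OF \<delta>_le[OF u w(1)], of "hi n - lo n"] T_lo[of n] T_hi[of n]
      by (simp add: mult_ac)
    also have "\<dots> = mat_pow_on S A k u w * (F n w - lo n * R w)"
      by (simp add: w(2) algebra_simps)
    also have "\<dots> \<le> (\<Sum>v\<in>S. mat_pow_on S A k u v * (F n v - lo n * R v))"
      using S w(1) pos[OF u] lo_le by (intro member_le_sum mult_nonneg_nonneg) (auto intro: less_imp_le)
    also have "\<dots> = G n u - lo n * (\<Sum>v\<in>S. mat_pow_on S A k u v * R v)"
      by (simp add: G_def right_diff_distrib sum_subtractf sum_distrib_left mult_ac)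
    finally show ?thesis unfolding eigk[OF u] by (simp add: algebra_simps)
  qed
  define \<epsilon> where "\<epsilon> n = (\<Sum>u\<in>S. \<bar>(F (n + k) u - G n u) / L n\<bar> / (r ^ k * R u))" for n
  have \<epsilon>0: "0 \<le> \<epsilon> n" for n
    unfolding \<epsilon>_def using R r by (intro sum_nonneg) (auto simp: less_imp_le)
  have lim\<epsilon>: "\<epsilon> \<longlonglongrightarrow> 0"
    unfolding \<epsilon>_def G_def divide_inverse[of _ "r ^ k * R _"]
    by (intro tendsto_null_sum tendsto_mult_left_zero tendsto_rabs_zero
        perturbed_iterates[OF S(1) L err])
  have close: "\<bar>F (n + k) v - G n v\<bar> \<le> \<epsilon> n * L n * (r ^ k * R v)" if v: "v \<in> S" for n v
  proof -
    have "\<bar>(F (n + k) v - G n v) / L n\<bar> / (r ^ k * R v) \<le> \<epsilon> n"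
      unfolding \<epsilon>_def using S(1) v R r by (intro member_le_sum) (auto simp: less_imp_le)
    then have "\<bar>(F (n + k) v - G n v) / L n\<bar> \<le> \<epsilon> n * (r ^ k * R v)"
      using R[OF v] r by (simp only: pos_divide_le_eq zero_less_power mult_pos_pos)
    then have "\<bar>F (n + k) v - G n v\<bar> \<le> \<epsilon> n * (r ^ k * R v) * L n"
      using L(1)[of n] by (simp add: abs_divide pos_divide_le_eq)
    then show ?thesis by (simp add: mult_ac)
  qed
  \<comment> \<open>The errors are measured against \<open>L n\<close>, the contraction against
    \<open>hi n\<close>; this comparison converts one into the other and is the origin of the factor
    2 below.\<close>
  have half: "eventually (\<lambda>n. L n \<le> 2 * hi n) sequentially"
  proof -
    have "eventually (\<lambda>n. 1 / 2 < T n / L n) sequentially"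
      unfolding T_def by (rule order_tendstoD(1)[OF tot]) simp
    then show ?thesis
    proof eventually_elim
      case (elim n)
      then have "L n < 2 * T n" using L(1)[of n] by (simp add: field_simps)
      with T_hi[of n] show ?case by linarith
    qed
  qed
  have "eventually (\<lambda>n. d (n + k) \<le> (1 - \<delta>) * d n + 4 * \<epsilon> n) sequentially"
    using half sequentially_offset[OF half, of k]
  proof eventually_elim
    case (elim n)
    define h where "h = r ^ k * hi n"
    have hpos: "0 < hi n" "0 < hi (n + k)" using elim L(1)[of n] L(1)[of "n + k"] by linarith+
    have h: "0 < h" using hpos r by (simp add: h_def)
    \<comment> \<open>Equal to \<open>1 - (1 - \<delta>) * d n\<close>: the lower bound for the
      ratio of minimum to maximum after \<open>k\<close> exact steps.\<close>
    define q where "q = lo n / hi n + \<delta> * (1 - lo n / hi n)"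
    have "lo n / hi n \<le> 1" using T_lo[of n] T_hi[of n] hpos by (simp add: divide_le_eq_1)
    then have q: "q \<le> 1"
      using \<delta> mult_right_mono[of \<delta> 1 "1 - lo n / hi n"] by (simp add: q_def)
    have hq: "h * q = r ^ k * (lo n + \<delta> * (hi n - lo n))"
      using hpos by (simp add: q_def h_def field_simps)
    have e2: "\<epsilon> n * L n * (r ^ k * R v) \<le> 2 * \<epsilon> n * h * R v" if "v \<in> S" for v
    proof -
      have "\<epsilon> n * L n * (r ^ k * R v) \<le> \<epsilon> n * (2 * hi n) * (r ^ k * R v)"
        using elim \<epsilon>0 r R[OF that] by (intro mult_right_mono mult_left_mono) auto
      then show ?thesis by (simp add: h_def mult_ac)
    qed
    have "hi (n + k) \<le> h * (1 + 2 * \<epsilon> n)"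
    proof (rule hi_leI)
      fix v assume v: "v \<in> S"
      show "F (n + k) v \<le> h * (1 + 2 * \<epsilon> n) * R v"
        using close[OF v, of n] e2[OF v] G_hi[OF v, of n] by (simp add: h_def algebra_simps)
    qed
    moreover have lo': "h * (q - 2 * \<epsilon> n) \<le> lo (n + k)"
    proof (rule lo_geI)
      fix v assume v: "v \<in> S"
      have "h * q * R v \<le> G n v" using G_lo[OF v, of n] by (simp add: hq)
      then show "h * (q - 2 * \<epsilon> n) * R v \<le> F (n + k) v"
        using close[OF v, of n] e2[OF v] by (simp add: algebra_simps)
    qed
    \<comment> \<open>Since \<open>q \<le> 1\<close>, the product of
      \<open>q - 4 * \<epsilon> n\<close> and \<open>1 + 2 * \<epsilon> n\<close> is at most
      \<open>q - 2 * \<epsilon> n\<close>. If \<open>q - 4 * \<epsilon> n\<close> is not positive,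
      the upper bound on \<open>hi (n + k)\<close> cannot be multiplied in, but then
      \<open>lo (n + k) \<ge> 0\<close> is enough.\<close>
    ultimately have "(q - 4 * \<epsilon> n) * hi (n + k) \<le> lo (n + k)"
    proof (cases "q - 4 * \<epsilon> n \<le> 0")
      case True
      then have "(q - 4 * \<epsilon> n) * hi (n + k) \<le> 0" using hpos by (intro mult_nonpos_nonneg) auto
      then show ?thesis using lo0[of "n + k"] by linarith
    next
      case False
      assume *: "hi (n + k) \<le> h * (1 + 2 * \<epsilon> n)"
      have "(q - 4 * \<epsilon> n) * hi (n + k) \<le> (q - 4 * \<epsilon> n) * (h * (1 + 2 * \<epsilon> n))"
        using False by (intro mult_left_mono *) auto
      also have "\<dots> = h * (q - 4 * \<epsilon> n + 2 * (\<epsilon> n * q) - 8 * \<epsilon> n ^ 2)"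
        by (simp add: algebra_simps power2_eq_square)
      also have "\<dots> \<le> h * (q - 2 * \<epsilon> n)"
      proof (rule mult_left_mono)
        have "\<epsilon> n * q \<le> \<epsilon> n" using mult_left_mono[OF q \<epsilon>0[of n]] by simp
        then show "q - 4 * \<epsilon> n + 2 * (\<epsilon> n * q) - 8 * \<epsilon> n ^ 2 \<le> q - 2 * \<epsilon> n"
          using zero_le_power2[of "\<epsilon> n"] by linarith
      qed (use h in simp)
      finally show ?thesis using lo' by linarith
    qed
    then have "q - 4 * \<epsilon> n \<le> lo (n + k) / hi (n + k)" using hpos by (simp add: pos_le_divide_eq)
    then show ?case by (simp add: d_def q_def left_diff_distrib right_diff_distrib diff_divide_distrib)
  qed
  from contraction_tendsto_0[OF d1 d0 \<delta> this] lim\<epsilon>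
  have limd: "d \<longlonglongrightarrow> 0" by (simp add: tendsto_mult_right_zero)
  \<comment> \<open>The coordinate attaining \<open>hi n\<close> contributes at least
    \<open>hi n * m\<close> to the total, so \<open>hi n\<close> is at most a constant times
    \<open>T n\<close>, and a small oscillation relative to \<open>hi n\<close> is also small
    relative to \<open>L n\<close>.\<close>
  define m where "m = Min (R ` S)"
  have m: "0 < m" "\<And>v. v \<in> S \<Longrightarrow> m \<le> R v" unfolding m_def using S R by auto
  have bound: "\<bar>F n u / L n - R u * (T n / L n)\<bar> \<le> d n * (T n / L n) * (R u / m)" for n
  proof -
    have "hi n * m \<le> T n"
    proof -
      obtain w where w: "w \<in> S" "F n w = hi n * R w" using hi_at by blast
      have "hi n * m \<le> F n w"
        unfolding w(2) using m(2)[OF w(1)] lo0[of n] T_lo[of n] T_hi[of n] by (intro mult_left_mono) auto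
      also have "\<dots> \<le> T n" unfolding T_def using S w(1) F by (intro member_le_sum) auto
      finally show ?thesis .
    qed
    then have hi: "hi n \<le> T n / m" using m(1) by (simp add: pos_le_divide_eq)
    have "\<bar>F n u - R u * T n\<bar> \<le> (hi n - lo n) * R u"
    proof -
      have "R u * lo n \<le> R u * T n" "R u * T n \<le> R u * hi n"
        using R[OF u] T_lo T_hi by (auto intro!: mult_left_mono)
      then show ?thesis using lo_le[OF u, of n] le_hi[OF u, of n] by (simp add: abs_le_iff algebra_simps)
    qed
    also have "hi n - lo n = d n * hi n"
      using lo0[of n] T_lo[of n] T_hi[of n] by (cases "hi n = 0") (auto simp: d_def field_simps)
    also have "d n * hi n * R u \<le> d n * (T n / m) * R u"
      using d0 hi R[OF u] by (intro mult_right_mono mult_left_mono) auto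
    finally have *: "\<bar>F n u - R u * T n\<bar> \<le> d n * (T n / m) * R u" .
    have "\<bar>F n u / L n - R u * (T n / L n)\<bar> = \<bar>F n u - R u * T n\<bar> / L n"
      using L(1)[of n] by (simp add: diff_divide_distrib[symmetric] abs_divide)
    also have "\<dots> \<le> d n * (T n / m) * R u / L n" using * L(1)[of n] by (intro divide_right_mono) auto
    finally show ?thesis by (simp add: mult_ac)
  qed
  have limT: "(\<lambda>n. T n / L n) \<longlonglongrightarrow> 1" using tot by (simp add: T_def)
  have "(\<lambda>n. d n * (T n / L n) * (R u / m)) \<longlonglongrightarrow> 0 * 1 * (R u / m)"
    by (intro tendsto_mult limd limT tendsto_const)
  then have "(\<lambda>n. d n * (T n / L n) * (R u / m)) \<longlonglongrightarrow> 0" by simp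
  then have "(\<lambda>n. F n u / L n - R u * (T n / L n)) \<longlonglongrightarrow> 0"
    by (rule Lim_null_comparison[rotated]) (simp only: real_norm_def bound eventually_True)
  from tendsto_add[OF this tendsto_mult[OF tendsto_const[of "R u"] limT]] show ?thesis by simp
qed

section \<open>Windows, legal words and primitivity of the induced matrix\<close>

text \<open>Counts the occurrences of \<open>u\<close> in \<open>w @ r\<close> that start inside
  \<open>w\<close>. Unlike \<open>occ\<close>, it adds up exactly over the blocks of a
  concatenation, and its expectation over images of a word gives the entries of the induced
  matrix.\<close>

definition win_count :: "'b list \<Rightarrow> 'b list \<Rightarrow> 'b list \<Rightarrow> nat" where
  "win_count u w r = (\<Sum>j<length w. of_bool (take (length u) (drop j (w @ r)) = u))"

lemma occ_eq_sum:
  assumes "u \<noteq> []"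
  shows "occ u x = (\<Sum>j<length x. of_bool (take (length u) (drop j x) = u))"
proof -
  have "{k. k + length u \<le> length x \<and> take (length u) (drop k x) = u}
      = {k \<in> {..<length x}. take (length u) (drop k x) = u}"
  proof (intro set_eqI iffI)
    fix k assume "k \<in> {k. k + length u \<le> length x \<and> take (length u) (drop k x) = u}"
    moreover have "0 < length u" using assms by simp
    ultimately show "k \<in> {k \<in> {..<length x}. take (length u) (drop k x) = u}"
      by (simp del: length_greater_0_conv)
  next
    fix k assume k: "k \<in> {k \<in> {..<length x}. take (length u) (drop k x) = u}"
    then have t: "k < length x" "take (length u) (drop k x) = u" by blast+
    have "length (take (length u) (drop k x)) \<le> length x - k" by simp
    then have "length u \<le> length x - k" by (simp only: t(2))
    with t(1) have "k + length u \<le> length x" by linarith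
    with t(2) show "k \<in> {k. k + length u \<le> length x \<and> take (length u) (drop k x) = u}" by blast
  qed
  then show ?thesis by (simp add: occ_def sum.inter_filter[symmetric] of_bool_def)
qed

lemma occ_Nil [simp]: "u \<noteq> [] \<Longrightarrow> occ u [] = 0"
  by (simp add: occ_eq_sum)

lemma occ_append:
  assumes "u \<noteq> []"
  shows "occ u (w @ r) = win_count u w r + occ u r"
proof -
  have "occ u (w @ r) = (\<Sum>j<length w + length r. of_bool (take (length u) (drop j (w @ r)) = u))"
    by (simp add: occ_eq_sum[OF assms])
  also have "\<dots> = win_count u w r
      + (\<Sum>j\<in>{length w..<length w + length r}. of_bool (take (length u) (drop j (w @ r)) = u))"
    unfolding win_count_def
    by (subst sum.union_disjoint[symmetric])
      (auto simp: ivl_disj_un simp del: sum_of_bool_eq drop_append take_append)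
  also have "(\<Sum>j\<in>{length w..<length w + length r}. of_bool (take (length u) (drop j (w @ r)) = u)) = occ u r"
    unfolding occ_eq_sum[OF assms]
    by (rule sum.reindex_bij_witness[of _ "\<lambda>j. j + length w" "\<lambda>j. j - length w"]) auto
  finally show ?thesis .
qed

lemma win_count_le: "win_count u w r \<le> length w"
proof -
  have "win_count u w r \<le> (\<Sum>j<length w. 1)" unfolding win_count_def by (intro sum_mono) simp
  then show ?thesis by simp
qed

lemma win_count_single: "win_count u [a] r = of_bool (take (length u) (a # r) = u)"
  by (simp add: win_count_def)

lemma occ_single: "occ [a] x = count_list x a"
  by (induction x) (use occ_append[of "[a]" "[_]"] in \<open>auto simp: win_count_single\<close>)

text \<open>Finite range of dependence: a window starting in \<open>w\<close> reads at most
  \<open>length u - 1\<close> letters beyond it.\<close>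

lemma win_count_take:
  assumes "u \<noteq> []"
  shows "win_count u w (take (length u - 1) r) = win_count u w r"
  unfolding win_count_def
proof (intro sum.cong refl)
  fix j assume "j \<in> {..<length w}"
  then have "length u - (length w - j) \<le> length u - 1" by auto
  then show "of_bool (take (length u) (drop j (w @ take (length u - 1) r)) = u)
           = (of_bool (take (length u) (drop j (w @ r)) = u) :: nat)"
    using \<open>j \<in> {..<length w}\<close> by (simp add: min_absorb1)
qed

lemma occ_pos_iff: "1 \<le> occ u x \<longleftrightarrow> (\<exists>p s. x = p @ u @ s)"
proof -
  have fin: "finite {k. k + length u \<le> length x \<and> take (length u) (drop k x) = u}"
    by (rule finite_subset[of _ "{..length x}"]) auto
  have "1 \<le> occ u x \<longleftrightarrow> (\<exists>k. k + length u \<le> length x \<and> take (length u) (drop k x) = u)"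
    using card_gt_0_iff[of "{k. k + length u \<le> length x \<and> take (length u) (drop k x) = u}"] fin
    unfolding occ_def Suc_le_eq One_nat_def by blast
  also have "\<dots> \<longleftrightarrow> (\<exists>p s. x = p @ u @ s)"
  proof
    assume "\<exists>k. k + length u \<le> length x \<and> take (length u) (drop k x) = u"
    then obtain k where "take (length u) (drop k x) = u" by blast
    then have "x = take k x @ u @ drop (length u) (drop k x)"
      by (metis append_take_drop_id)
    then show "\<exists>p s. x = p @ u @ s" by blast
  next
    assume "\<exists>p s. x = p @ u @ s"
    then obtain p s where "x = p @ u @ s" by blast
    then show "\<exists>k. k + length u \<le> length x \<and> take (length u) (drop k x) = u"
      by (intro exI[of _ "length p"]) simp
  qed
  finally show ?thesis .
qed

lemma concat_position:
  assumes "j < length (concat ws)"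
  shows "\<exists>i j'. i < length ws \<and> j' < length (ws ! i) \<and> j = length (concat (take i ws)) + j'"
  using assms
proof (induction ws arbitrary: j)
  case (Cons w ws)
  show ?case
  proof (cases "j < length w")
    case True
    then show ?thesis by (intro exI[of _ 0] exI[of _ j]) auto
  next
    case False
    with Cons.prems have "j - length w < length (concat ws)" by simp
    from Cons.IH[OF this] obtain i j' where
      "i < length ws" "j' < length (ws ! i)" "j - length w = length (concat (take i ws)) + j'" by blast
    with False show ?thesis by (intro exI[of _ "Suc i"] exI[of _ j']) auto
  qed
qed simp

lemma length_le_concat:
  assumes "[] \<notin> set ws"
  shows "length ws \<le> length (concat ws)"
  using assms
proof (induction ws)
  case (Cons w ws)
  then have "1 \<le> length w" by (cases w) auto
  with Cons show ?case by simp
qed simp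

lemma expectation_pos:
  fixes f :: "'b \<Rightarrow> real"
  assumes "finite (set_pmf p)" "\<And>x. 0 \<le> f x" "x \<in> set_pmf p" "0 < f x"
  shows "0 < measure_pmf.expectation p f"
proof -
  have "measure_pmf.expectation p f = (\<Sum>y\<in>set_pmf p. f y * pmf p y)"
    by (rule integral_measure_pmf_real) (auto simp: assms)
  also have "\<dots> > 0"
    using assms by (intro sum_pos2[of _ x]) (auto simp: pmf_positive)
  finally show ?thesis .
qed

section \<open>Supports, independence over concatenation, and legality\<close>

lemma set_pmf_subst_blocks:
  "set_pmf (subst_blocks P u) = {ws. list_all2 (\<lambda>w a. w \<in> set_pmf (P a)) ws u}"
proof (induction u)
  case (Cons a u)
  then show ?case by (auto simp: list_all2_Cons2)
qed simp

lemma subst_blocks_append: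
  "subst_blocks P (x @ y) = map_pmf (\<lambda>(v, w). v @ w) (pair_pmf (subst_blocks P x) (subst_blocks P y))"
  by (induction x)
    (simp_all add: pair_pmf_def map_bind_pmf bind_return_pmf bind_assoc_pmf bind_return_pmf' map_pmf_def)

lemma subst_kernel_append:
  "subst_kernel P (x @ y) = map_pmf (\<lambda>(v, w). v @ w) (pair_pmf (subst_kernel P x) (subst_kernel P y))"
  by (simp add: subst_kernel_def subst_blocks_append pair_pmf_def map_pmf_def bind_return_pmf bind_assoc_pmf)

text \<open>The branching property: two factors of a word evolve independently.\<close>

lemma subst_iter_append:
  "subst_iter P n (x @ y) = map_pmf (\<lambda>(v, w). v @ w) (pair_pmf (subst_iter P n x) (subst_iter P n y))"
proof (induction n)
  case 0
  then show ?case by (simp add: pair_pmf_def bind_return_pmf)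
next
  case (Suc n)
  show ?case
    unfolding subst_iter.simps(2) Suc
    unfolding pair_pmf_def map_pmf_def
    apply (simp add: bind_return_pmf bind_assoc_pmf subst_kernel_append)
    apply (simp add: bind_return_pmf bind_assoc_pmf pair_pmf_def map_pmf_def)
    apply (rule bind_pmf_cong[OF refl])
    \<comment> \<open>The next image of the left factor and the \<open>n\<close>-th iterate of the
      right factor are drawn independently, so their order may be exchanged.\<close>
    apply (rule bind_commute_pmf)
    done
qed

lemma subst_iter_add: "subst_iter P (m + n) u = bind_pmf (subst_iter P n u) (subst_iter P m)"
  by (induction m) (simp_all add: bind_return_pmf' bind_assoc_pmf)

text \<open>Lets possible evolutions of a factor be pasted into a possible evolution of the whole
  word, the surrounding parts being filled with any words from their supports.\<close>

lemma subst_iter_factor: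
  assumes "x = p @ z @ s" "y \<in> set_pmf (subst_iter P n z)"
  shows "\<exists>p' s'. p' @ y @ s' \<in> set_pmf (subst_iter P n x)"
proof -
  obtain p' s' where "p' \<in> set_pmf (subst_iter P n p)" "s' \<in> set_pmf (subst_iter P n s)"
    using set_pmf_not_empty[of "subst_iter P n p"] set_pmf_not_empty[of "subst_iter P n s"] by blast
  then have "p' @ y @ s' \<in> set_pmf (subst_iter P n x)"
    unfolding assms(1) subst_iter_append using assms(2) by force
  then show ?thesis by blast
qed

lemma subst_matrix_nonneg: "0 \<le> subst_matrix P a b"
  unfolding subst_matrix_def by (rule integral_nonneg_AE) simp

lemma induced_matrix_nonneg: "0 \<le> induced_matrix P l u v"
  unfolding induced_matrix_def by (rule integral_nonneg_AE) simp

lemma induced_matrix_eq: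
  assumes "length u = l" "v \<noteq> []"
  shows "induced_matrix P l u v
       = measure_pmf.expectation (subst_blocks P v) (\<lambda>ws. real (win_count u (hd ws) (concat (tl ws))))"
  unfolding induced_matrix_def induced_law_def integral_map_pmf
proof (rule integral_cong_AE)
  show "AE ws in measure_pmf (subst_blocks P v).
     real (occ [u] (map (\<lambda>k. take l (drop k (concat ws))) [0..<length (hd ws)]))
     = real (win_count u (hd ws) (concat (tl ws)))"
  proof (rule AE_pmfI)
    fix ws assume "ws \<in> set_pmf (subst_blocks P v)"
    then have "ws \<noteq> []" using assms(2) by (auto simp: set_pmf_subst_blocks)
    then have eq: "concat ws = hd ws @ concat (tl ws)" by (cases ws) auto
    have "occ [u] (map (\<lambda>k. take l (drop k (concat ws))) [0..<length (hd ws)])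
        = win_count u (hd ws) (concat (tl ws))"
      unfolding win_count_def eq[symmetric]
      by (subst occ_eq_sum, simp, rule sum.cong) (auto simp: assms(1) take_Suc_conv_app_nth Cons_nth_drop_Suc[symmetric])
    then show "real (occ [u] (map (\<lambda>k. take l (drop k (concat ws))) [0..<length (hd ws)]))
     = real (win_count u (hd ws) (concat (tl ws)))" by simp
  qed
qed simp_all

lemma legal_words_iff:
  "u \<in> legal_words P \<longleftrightarrow> u \<noteq> [] \<and> (\<exists>n a p s. p @ u @ s \<in> set_pmf (subst_iter P n [a]))"
proof -
  have "pmf q v > 0 \<longleftrightarrow> v \<in> set_pmf q" for q :: "'a list pmf" and v
    by (simp add: set_pmf_iff less_le)
  then show ?thesis unfolding legal_words_def occ_pos_iff by blast
qed

lemma legal_words_factor: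
  "p @ u @ s \<in> legal_words P \<Longrightarrow> u \<noteq> [] \<Longrightarrow> u \<in> legal_words P"
  unfolding legal_words_iff by (metis append.assoc)

lemma legal_words_subst:
  assumes "u \<in> legal_words P" "y \<in> set_pmf (subst_kernel P u)" "y \<noteq> []"
  shows "y \<in> legal_words P"
proof -
  obtain n a p s where *: "p @ u @ s \<in> set_pmf (subst_iter P n [a])"
    using assms(1) by (auto simp: legal_words_iff)
  have "y \<in> set_pmf (subst_iter P 1 u)" using assms(2) by (simp add: bind_return_pmf)
  from subst_iter_factor[OF refl this, of p s] obtain p' s' where
    "p' @ y @ s' \<in> set_pmf (subst_iter P 1 (p @ u @ s))" by blast
  then have "p' @ y @ s' \<in> set_pmf (subst_iter P (1 + n) [a])"
    unfolding subst_iter_add set_bind_pmf using * by blast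
  then show ?thesis using assms(3) unfolding legal_words_iff by blast
qed

lemma finite_legal_words_of_length: "finite (legal_words_of_length (P :: 'a::finite \<Rightarrow> _) l)"
  by (rule finite_subset[OF _ finite_lists_length_eq[of UNIV l]]) (auto simp: legal_words_of_length_def)

context
  fixes P :: "'a::finite \<Rightarrow> 'a list pmf"
  assumes rs: "random_substitution P"
begin

lemma finite_subst_blocks: "finite (set_pmf (subst_blocks P u))"
proof (induction u)
  case (Cons a u)
  then show ?case using rs by (auto simp: random_substitution_def)
qed simp

lemma finite_subst_kernel: "finite (set_pmf (subst_kernel P u))"
  by (simp add: subst_kernel_def finite_subst_blocks)

lemma finite_subst_iter: "finite (set_pmf (subst_iter P n u))"
  by (induction n) (auto simp: finite_subst_kernel)

lemma subst_blocks_nonempty: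
  assumes "ws \<in> set_pmf (subst_blocks P u)"
  shows "[] \<notin> set ws"
proof
  assume "[] \<in> set ws"
  moreover have "list_all2 (\<lambda>w a. w \<in> set_pmf (P a)) ws u"
    using assms by (simp add: set_pmf_subst_blocks)
  ultimately obtain a where "[] \<in> set_pmf (P a)"
    by (metis in_set_conv_nth list_all2_nthD)
  then show False using rs by (simp add: random_substitution_def)
qed

lemma length_subst_blocks: "ws \<in> set_pmf (subst_blocks P u) \<Longrightarrow> length ws = length u"
  by (simp add: set_pmf_subst_blocks list_all2_lengthD)

lemma length_subst_kernel_ge: "y \<in> set_pmf (subst_kernel P u) \<Longrightarrow> length u \<le> length y"
  using length_le_concat[OF subst_blocks_nonempty] length_subst_blocks
  unfolding subst_kernel_def by fastforce

lemma length_subst_iter_ge: "y \<in> set_pmf (subst_iter P n u) \<Longrightarrow> length u \<le> length y"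
proof (induction n arbitrary: y)
  case (Suc n)
  then obtain x where "x \<in> set_pmf (subst_iter P n u)" "y \<in> set_pmf (subst_kernel P x)" by auto
  with Suc.IH[of x] length_subst_kernel_ge[of y x] show ?case by simp
qed simp

section \<open>From positive matrix entries to possible words and back\<close>

lemma subst_matrix_pow_pos:
  assumes "0 < mat_pow_on UNIV (subst_matrix P) k a c"
  shows "\<exists>x\<in>set_pmf (subst_iter P k [c]). a \<in> set x"
  using assms
proof (induction k arbitrary: a)
  case 0
  then show ?case by (auto split: if_splits)
next
  case (Suc k)
  then have "(\<Sum>b\<in>UNIV. subst_matrix P a b * mat_pow_on UNIV (subst_matrix P) k b c) \<noteq> 0"
    by simp
  then obtain b where b: "subst_matrix P a b * mat_pow_on UNIV (subst_matrix P) k b c \<noteq> 0"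
    using sum.not_neutral_contains_not_neutral by blast
  moreover have "0 \<le> mat_pow_on UNIV (subst_matrix P) k b c"
    by (intro mat_pow_nonneg subst_matrix_nonneg) auto
  ultimately have "0 < mat_pow_on UNIV (subst_matrix P) k b c" by auto
  from Suc.IH[OF this] obtain x where x: "x \<in> set_pmf (subst_iter P k [c])" "b \<in> set x" by blast
  have "\<exists>w\<in>set_pmf (P b). occ [a] w \<noteq> 0"
  proof (rule ccontr)
    assume "\<not> ?thesis"
    then have "subst_matrix P a b = (\<integral>w. 0 \<partial>measure_pmf (P b))"
      unfolding subst_matrix_def by (intro integral_cong_AE) (auto simp: AE_measure_pmf_iff)
    with b show False by simp
  qed
  then obtain w where w: "w \<in> set_pmf (P b)" "a \<in> set w" by (auto simp: occ_single count_list_0_iff)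
  obtain p s where "x = p @ [b] @ s" using split_list[OF x(2)] by auto
  moreover have "w \<in> set_pmf (subst_iter P 1 [b])"
    using w(1) by (force simp: bind_return_pmf subst_kernel_def)
  ultimately obtain p' s' where "p' @ w @ s' \<in> set_pmf (subst_iter P 1 x)"
    using subst_iter_factor by blast
  with x(1) have "p' @ w @ s' \<in> set_pmf (subst_iter P (1 + k) [c])"
    unfolding subst_iter_add set_bind_pmf by blast
  moreover have "a \<in> set (p' @ w @ s')" using w(2) by simp
  ultimately show ?case unfolding plus_1_eq_Suc by blast
qed

text \<open>Monotonicity in m comes from spending the first \<open>m - k\<close> steps arbitrarily:
  they produce a non-empty word, and any of its letters can generate any other in \<open>k\<close>
  steps.\<close>

lemma primitive_letters:
  assumes "primitive_substitution P"
  shows "\<exists>k. \<forall>m\<ge>k. \<forall>a c. \<exists>x\<in>set_pmf (subst_iter P m [c]). a \<in> set x"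
proof -
  obtain k where k: "\<And>a c. 0 < mat_pow_on UNIV (subst_matrix P) k a c"
    using assms by (auto simp: primitive_substitution_def primitive_matrix_def)
  have "\<exists>x\<in>set_pmf (subst_iter P m [c]). a \<in> set x" if "m \<ge> k" for m a c
  proof -
    obtain z where z: "z \<in> set_pmf (subst_iter P (m - k) [c])" using set_pmf_not_empty by fast
    then have "z \<noteq> []" using length_subst_iter_ge by fastforce
    then obtain b where "b \<in> set z" by (meson ex_in_conv set_empty)
    then obtain p s where "z = p @ [b] @ s" using split_list[of b z] by auto
    moreover obtain y where "y \<in> set_pmf (subst_iter P k [b])" "a \<in> set y"
      using subst_matrix_pow_pos[OF k] by blast
    ultimately obtain x where "x \<in> set_pmf (subst_iter P k z)" "a \<in> set x"
      using subst_iter_factor[of z p "[b]" s y P k] by force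
    then have "x \<in> set_pmf (subst_iter P (k + (m - k)) [c])"
      unfolding subst_iter_add set_bind_pmf using z by blast
    with \<open>a \<in> set x\<close> that show ?thesis by auto
  qed
  then show ?thesis by blast
qed

text \<open>Every window has a genealogy. Its first letter lies in the image of a parent letter, and
  the window of length \<open>l\<close> at that parent already determines it; following parents back
  to \<open>v\<close> gives a path of positive entries of the induced matrix.\<close>

lemma windows_along_iterates:
  assumes "v \<in> legal_words_of_length P l"
    and "y1 \<in> set_pmf (subst_iter P n [hd v])" "y2 \<in> set_pmf (subst_iter P n (tl v))" "j < length y1"
  defines "S \<equiv> legal_words_of_length P l" and "u \<equiv> take l (drop j (y1 @ y2))"
  shows "u \<in> S \<and> 0 < mat_pow_on S (induced_matrix P l) n u v"
proof -
  let ?A = "induced_matrix P l"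
  have v: "length v = l" "v \<noteq> []" using assms(1) by (auto simp: legal_words_of_length_def legal_words_iff)
  have "take l (drop j (y1 @ y2)) \<in> S \<and> 0 < mat_pow_on S ?A n (take l (drop j (y1 @ y2))) v"
    using assms(2-4)
  proof (induction n arbitrary: y1 y2 j)
    case 0
    then show ?case using v assms(1) by (simp add: S_def)
  next
    case (Suc n)
    obtain x1 ws1 where x1: "x1 \<in> set_pmf (subst_iter P n [hd v])"
      and ws1: "ws1 \<in> set_pmf (subst_blocks P x1)" "y1 = concat ws1"
      using Suc.prems(1) by (auto simp: subst_kernel_def)
    obtain x2 ws2 where x2: "x2 \<in> set_pmf (subst_iter P n (tl v))"
      and ws2: "ws2 \<in> set_pmf (subst_blocks P x2)" "y2 = concat ws2"
      using Suc.prems(2) by (auto simp: subst_kernel_def)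
    \<comment> \<open>\<open>i\<close> is the position of the parent letter and \<open>j'\<close>
      the offset inside its image.\<close>
    obtain i j' where i: "i < length ws1" "j' < length (ws1 ! i)" "j = length (concat (take i ws1)) + j'"
      using concat_position[of j ws1] Suc.prems(3) ws1(2) by auto
    have len: "length ws1 = length x1" "length ws2 = length x2"
      using ws1(1) ws2(1) length_subst_blocks by auto
    \<comment> \<open>Words never shrink, so the descendants of \<open>tl v\<close> have at least
      \<open>l - 1\<close> letters and a parent window starting anywhere in \<open>x1\<close> has
      full length.\<close>
    have x2l: "l \<le> Suc (length x2)" using length_subst_iter_ge[OF x2] v by simp
    define u' where "u' = take l (drop i (x1 @ x2))"
    define ws where "ws = take l (drop i (ws1 @ ws2))"
    have IH: "u' \<in> S" "0 < mat_pow_on S ?A n u' v"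
      using Suc.IH[OF x1 x2, of i] i(1) len by (auto simp: u'_def)
    have l: "0 < l" using v by auto
    have ws: "ws \<in> set_pmf (subst_blocks P u')"
      using ws1(1) ws2(1) unfolding set_pmf_subst_blocks ws_def u'_def mem_Collect_eq
      by (intro list_all2_takeI list_all2_dropI list_all2_appendI)
    have lws: "length ws = l" using i(1) len x2l by (simp add: ws_def)
    have hd_ws: "hd ws = ws1 ! i"
      using i(1) l by (simp add: ws_def hd_drop_conv_nth nth_append)
    obtain w t where wt: "ws = w # t" using lws l by (cases ws) auto
    \<comment> \<open>The \<open>l - 1\<close> images after the first are non-empty, so a window of
      length \<open>l\<close> starting in the first image stays inside the image of the parent
      window.\<close>
    have "length t \<le> length (concat t)"
      using subst_blocks_nonempty[OF ws] wt by (intro length_le_concat) auto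
    then have long: "j' + l \<le> length (concat ws)"
      using i(2) hd_ws wt lws by simp
    have "y1 @ y2 = concat (take i ws1) @ concat ws @ concat (drop l (drop i (ws1 @ ws2)))"
      using i(1) unfolding ws_def ws1(2) ws2(2) concat_append[symmetric] append_take_drop_id
      by (metis append_take_drop_id append.assoc drop_append diff_is_0_eq' drop0 less_imp_le)
    then have u: "take l (drop j (y1 @ y2)) = take l (drop j' (concat ws))"
      using long by (simp add: i(3))
    define u where "u = take l (drop j' (concat ws))"
    have ul: "length u = l" using long by (simp add: u_def)
    have "concat ws \<in> set_pmf (subst_kernel P u')" using ws by (auto simp: subst_kernel_def)
    moreover have "0 < length (concat ws)" using long l by linarith
    moreover have "u' \<in> legal_words P" using IH(1) by (simp add: S_def legal_words_of_length_def)
    ultimately have "concat ws \<in> legal_words P"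
      unfolding length_greater_0_conv using legal_words_subst[of u' P "concat ws"] by blast
    moreover have "concat ws = take j' (concat ws) @ u @ drop l (drop j' (concat ws))"
      unfolding u_def by (simp only: append_take_drop_id)
    ultimately have "take j' (concat ws) @ u @ drop l (drop j' (concat ws)) \<in> legal_words P"
      by (simp only:)
    moreover have "u \<noteq> []" using ul l by auto
    ultimately have uS: "u \<in> S"
      using ul legal_words_factor unfolding S_def legal_words_of_length_def by blast
    have "0 < ?A u u'"
    proof (subst induced_matrix_eq[OF ul])
      show "u' \<noteq> []" using IH(1) by (auto simp: S_def legal_words_of_length_def legal_words_iff)
      have "concat ws = hd ws @ concat (tl ws)" by (simp add: wt)
      then have "of_bool (take (length u) (drop j' (hd ws @ concat (tl ws))) = u) = (1::nat)"
        unfolding ul by (simp only: u_def of_bool_eq simp_thms)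
      then have "1 \<le> win_count u (hd ws) (concat (tl ws))"
        unfolding win_count_def using i(2) hd_ws
        by (metis (no_types, lifting) finite_lessThan lessThan_iff member_le_sum zero_le)
      then show "0 < measure_pmf.expectation (subst_blocks P u')
          (\<lambda>ws. real (win_count u (hd ws) (concat (tl ws))))"
        by (intro expectation_pos[OF finite_subst_blocks _ ws]) auto
    qed
    then have "0 < mat_pow_on S ?A (Suc n) u v"
      unfolding mat_pow_on.simps using IH
      by (intro sum_pos2[of _ u'])
        (use assms(1) in \<open>auto simp: S_def finite_legal_words_of_length intro!: mult_nonneg_nonneg mat_pow_nonneg induced_matrix_nonneg\<close>)
    then show ?case using uS unfolding u u_def by blast
  qed
  then show ?thesis by (simp add: u_def)
qed

lemma induced_matrix_primitive:
  assumes "primitive_substitution P"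
  shows "primitive_matrix (legal_words_of_length P l) (induced_matrix P l)"
proof -
  define S where "S = legal_words_of_length P l"
  obtain k where k: "\<And>m a c. m \<ge> k \<Longrightarrow> \<exists>x\<in>set_pmf (subst_iter P m [c]). a \<in> set x"
    using primitive_letters[OF assms] by blast
  have "\<forall>u\<in>S. \<exists>n a p s. p @ u @ s \<in> set_pmf (subst_iter P n [a])"
    by (auto simp: S_def legal_words_of_length_def legal_words_iff)
  then obtain n where n: "\<forall>u\<in>S. \<exists>a p s. p @ u @ s \<in> set_pmf (subst_iter P (n u) [a])"
    by metis
  \<comment> \<open>One exponent for all pairs: \<open>u\<close> appears \<open>n u\<close> steps
    after a suitable letter, and that letter can be reached in every number of steps from
    \<open>k\<close> on, so the remaining \<open>N - n u\<close> steps are always enough.\<close>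
  define N where "N = Suc k + (\<Sum>u\<in>S. n u)"
  have fin: "finite S" by (simp add: S_def finite_legal_words_of_length)
  have "0 < mat_pow_on S (induced_matrix P l) N u v" if u: "u \<in> S" and v: "v \<in> S" for u v
  proof -
    obtain b p s where b: "p @ u @ s \<in> set_pmf (subst_iter P (n u) [b])" using n u by blast
    have nu: "n u \<le> (\<Sum>u\<in>S. n u)" using u fin by (intro member_le_sum) auto
    then have "k \<le> N - n u" unfolding N_def by linarith
    from k[OF this] obtain x where x: "x \<in> set_pmf (subst_iter P (N - n u) [hd v])" "b \<in> set x" by blast
    then obtain p' s' where "x = p' @ [b] @ s'" using split_list[of b x] by auto
    from subst_iter_factor[OF this b] obtain p'' s'' where
      "p'' @ (p @ u @ s) @ s'' \<in> set_pmf (subst_iter P (n u) x)" by blast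
    with x(1) have "p'' @ (p @ u @ s) @ s'' \<in> set_pmf (subst_iter P (n u + (N - n u)) [hd v])"
      unfolding subst_iter_add set_bind_pmf by blast
    moreover have "n u + (N - n u) = N" using nu by (simp add: N_def)
    ultimately have y1: "p'' @ (p @ u @ s) @ s'' \<in> set_pmf (subst_iter P N [hd v])" by simp
    obtain y2 where y2: "y2 \<in> set_pmf (subst_iter P N (tl v))" using set_pmf_not_empty by fast
    have "u \<noteq> []" "length u = l" using u by (auto simp: S_def legal_words_of_length_def legal_words_iff)
    with windows_along_iterates[OF v[unfolded S_def] y1 y2, of "length (p'' @ p)"]
    show ?thesis by (auto simp: S_def)
  qed
  moreover have "1 \<le> N" by (simp add: N_def)
  ultimately show ?thesis
    unfolding primitive_matrix_def S_def[symmetric] by (auto simp: induced_matrix_nonneg)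
qed

end

section \<open>Growth of the word length\<close>

lemma expectation_bind_finite:
  fixes f :: "'b \<Rightarrow> real"
  assumes "finite (set_pmf p)" "\<And>x. x \<in> set_pmf p \<Longrightarrow> finite (set_pmf (q x))"
  shows "measure_pmf.expectation (bind_pmf p q) f
       = measure_pmf.expectation p (\<lambda>x. measure_pmf.expectation (q x) f)"
proof -
  have "measure_pmf.expectation (bind_pmf p q) f
      = (\<Sum>x\<in>set_pmf p. pmf p x *\<^sub>R measure_pmf.expectation (q x) f)"
    by (rule pmf_expectation_bind[OF assms(1,2)]) auto
  also have "\<dots> = measure_pmf.expectation p (\<lambda>x. measure_pmf.expectation (q x) f)"
    by (rule integral_measure_pmf[symmetric]) (auto simp: assms(1))
  finally show ?thesis .
qed

lemma expectation_mono_finite: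
  fixes f g :: "'b \<Rightarrow> real"
  assumes "finite (set_pmf p)" "\<And>x. x \<in> set_pmf p \<Longrightarrow> f x \<le> g x"
  shows "measure_pmf.expectation p f \<le> measure_pmf.expectation p g"
  using assms by (intro integral_mono_AE integrable_measure_pmf_finite) (auto simp: AE_measure_pmf_iff)

lemma expectation_pair_mult:
  fixes f :: "'b \<Rightarrow> real" and g :: "'c \<Rightarrow> real"
  assumes "finite (set_pmf p)" "finite (set_pmf q)"
  shows "measure_pmf.expectation (pair_pmf p q) (\<lambda>x. f (fst x) * g (snd x))
       = measure_pmf.expectation p f * measure_pmf.expectation q g"
  unfolding pair_pmf_def
  by (subst expectation_bind_finite, use assms in simp, use assms in simp,
      subst expectation_bind_finite) (use assms in simp_all)

text \<open>Shifting a partial sum by \<open>k\<close> bounds it by a constant plus \<open>q\<close>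
  times itself; with \<open>q < 1\<close> this bounds all partial sums.\<close>

lemma summable_geometric_steps:
  fixes s :: "nat \<Rightarrow> real"
  assumes s: "\<And>n. 0 \<le> s n" "\<And>n. s (n + k) \<le> q * s n" and q: "q < 1"
  shows "summable s"
proof (rule summableI_nonneg_bounded[OF s(1)])
  fix N
  have "(\<Sum>n<N. s n) \<le> (\<Sum>n<k + N. s n)"
    by (intro sum_mono2) (auto simp: s(1))
  also have "\<dots> = (\<Sum>n<k. s n) + (\<Sum>n<N. s (n + k))"
    using sum.atLeastLessThan_concat[of 0 k "k + N" s] sum.shift_bounds_nat_ivl[of s 0 k N]
    by (simp add: lessThan_atLeast0 add.commute)
  also have "\<dots> \<le> (\<Sum>n<k. s n) + q * (\<Sum>n<N. s n)"
    unfolding sum_distrib_left by (intro add_left_mono sum_mono s(2))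
  finally have "(\<Sum>n<N. s n) * (1 - q) \<le> (\<Sum>n<k. s n)" by (simp add: algebra_simps)
  then show "(\<Sum>n<N. s n) \<le> (\<Sum>n<k. s n) / (1 - q)" using q by (simp add: pos_le_divide_eq)
qed

lemma map_tl_subst_blocks: "map_pmf tl (subst_blocks P (a # x)) = subst_blocks P x"
  by (simp add: map_bind_pmf bind_return_pmf')

definition inv_length :: "('a \<Rightarrow> 'a list pmf) \<Rightarrow> nat \<Rightarrow> 'a list \<Rightarrow> real" where
  "inv_length P n x = measure_pmf.expectation (subst_iter P n x) (\<lambda>y. 1 / real (length y))"

lemma inv_length_nonneg: "0 \<le> inv_length P n x"
  unfolding inv_length_def by (rule integral_nonneg_AE) simp

context
  fixes P :: "'a::finite \<Rightarrow> 'a list pmf"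
  assumes rs: "random_substitution P"
begin

text \<open>By Cauchy--Schwarz, \<open>(1 + m)\<^sup>2 / (A + B) \<le> 1 / A + m\<^sup>2 / B\<close>.\<close>

lemma inv_length_le:
  assumes "\<And>a. inv_length P n [a] \<le> G" "x \<noteq> []"
  shows "inv_length P n x \<le> G / real (length x)"
  using assms(2)
proof (induction x rule: list_nonempty_induct)
  case (single a)
  then show ?case using assms(1) by simp
next
  case (cons a x)
  \<comment> \<open>Weights 1 and m match the expected sizes of the two parts: the induction
    hypothesis turns the bound into \<open>(G + m\<^sup>2 * (G / m)) / (1 + m)\<^sup>2\<close>,
    which is exactly \<open>G / (1 + m)\<close>.\<close>
  define m where "m = real (length x)"
  have m: "0 < m" using cons.hyps by (simp add: m_def)
  let ?p = "pair_pmf (subst_iter P n [a]) (subst_iter P n x)"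
  have fin: "finite (set_pmf ?p)" by (simp add: finite_subst_iter[OF rs])
  have "inv_length P n (a # x) = measure_pmf.expectation ?p (\<lambda>y. 1 / real (length (fst y) + length (snd y)))"
    using subst_iter_append[of P n "[a]" x] by (simp add: inv_length_def case_prod_unfold)
  also have "\<dots> \<le> measure_pmf.expectation ?p
      (\<lambda>y. (1 / real (length (fst y)) + m\<^sup>2 * (1 / real (length (snd y)))) / (1 + m)\<^sup>2)"
  proof (rule expectation_mono_finite[OF fin])
    fix y assume "y \<in> set_pmf ?p"
    then have "1 \<le> length (fst y)" "1 \<le> length (snd y)"
      using length_subst_iter_ge[OF rs, of "fst y" n "[a]"] length_subst_iter_ge[OF rs, of "snd y" n x] cons.hyps
      by (cases x; auto)+
    then have pos: "0 < real (length (fst y))" "0 < real (length (snd y))" by linarith+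
    define A B where "A = real (length (fst y))" and "B = real (length (snd y))"
    have AB: "0 < A" "0 < B" using pos by (simp_all add: A_def B_def)
    \<comment> \<open>After expansion the difference of the two sides is the square of
      \<open>B - m * A\<close>.\<close>
    have "(1 + m)\<^sup>2 * (A * B) \<le> (B + m\<^sup>2 * A) * (A + B)"
      using zero_le_power2[of "B - m * A"] by (simp add: power2_eq_square algebra_simps)
    then have "(1 + m)\<^sup>2 \<le> (B + m\<^sup>2 * A) * (A + B) / (A * B)" using AB by (simp add: pos_le_divide_eq)
    also have "\<dots> = (1 / A + m\<^sup>2 * (1 / B)) * (A + B)" using AB by (simp add: field_simps)
    finally have "1 / (A + B) \<le> (1 / A + m\<^sup>2 * (1 / B)) / (1 + m)\<^sup>2"
      using AB m by (simp add: pos_divide_le_eq pos_le_divide_eq mult_ac)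
    then show "1 / real (length (fst y) + length (snd y))
        \<le> (1 / real (length (fst y)) + m\<^sup>2 * (1 / real (length (snd y)))) / (1 + m)\<^sup>2"
      by (simp add: A_def B_def)
  qed
  also have "\<dots> = (inv_length P n [a] + m\<^sup>2 * inv_length P n x) / (1 + m)\<^sup>2"
    unfolding inv_length_def integral_divide_zero
    by (subst Bochner_Integration.integral_add)
      (simp_all add: integrable_measure_pmf_finite[OF fin] del: times_divide_eq_right
        add: expectation_pair_pmf_fst[of _ _ "\<lambda>y. 1 / real (length y)"] expectation_pair_pmf_snd[of _ _ "\<lambda>y. 1 / real (length y)"])
  also have "\<dots> \<le> (G + m\<^sup>2 * (G / m)) / (1 + m)\<^sup>2"
    using cons.IH assms(1)[of a] by (intro divide_right_mono add_mono mult_left_mono) (auto simp: m_def)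
  also have "G + m\<^sup>2 * (G / m) = G * (1 + m)" using m by (simp add: power2_eq_square algebra_simps)
  also have "G * (1 + m) / (1 + m)\<^sup>2 = G / (1 + m)" using m by (simp add: power2_eq_square)
  finally show ?case by (simp add: m_def)
qed

text \<open>Conditioning on the word after n steps, each of its letters starts an independent
  population for m further steps, so the previous bound applies to it.\<close>

lemma inv_length_add:
  assumes "\<And>a. inv_length P m [a] \<le> G"
  shows "inv_length P (m + n) [a] \<le> G * inv_length P n [a]"
proof -
  have "inv_length P (m + n) [a] = measure_pmf.expectation (subst_iter P n [a]) (inv_length P m)"
    unfolding inv_length_def subst_iter_add
    by (subst expectation_bind_finite) (simp_all add: finite_subst_iter[OF rs])
  also have "\<dots> \<le> measure_pmf.expectation (subst_iter P n [a]) (\<lambda>y. G * (1 / real (length y)))"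
  proof (rule expectation_mono_finite[OF finite_subst_iter[OF rs]])
    fix y assume "y \<in> set_pmf (subst_iter P n [a])"
    then have "y \<noteq> []" using length_subst_iter_ge[OF rs, of y n "[a]"] by auto
    with inv_length_le[OF assms] show "inv_length P m y \<le> G * (1 / real (length y))" by simp
  qed
  finally show ?thesis by (simp add: inv_length_def del: times_divide_eq_right)
qed

text \<open>With positive probability the letter with a long image has appeared after
  \<open>k\<close> steps, and one further step then yields at least two letters. So the expected
  inverse length after \<open>1 + k\<close> steps is below 1 for every initial letter, and finitely
  many letters give a uniform contraction factor.\<close>

lemma summable_inv_length:
  assumes "primitive_substitution P" "expanding_substitution P"
  shows "summable (\<lambda>n. inv_length P n [a])"
proof -
  obtain k where k: "\<And>a c. \<exists>x\<in>set_pmf (subst_iter P k [c]). a \<in> set x"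
    using primitive_letters[OF rs assms(1)] by blast
  obtain b w where w: "w \<in> set_pmf (P b)" "1 < length w"
    using assms(2) measure_pmf_zero_iff unfolding expanding_substitution_def
    by (metis (mono_tags, lifting) disjoint_iff less_irrefl mem_Collect_eq)
  have "inv_length P (1 + k) [c] < 1" for c
  proof -
    obtain x where x: "x \<in> set_pmf (subst_iter P k [c])" "b \<in> set x" using k by blast
    obtain p s where "x = p @ [b] @ s" using split_list[OF x(2)] by auto
    moreover have "w \<in> set_pmf (subst_iter P 1 [b])"
      using w(1) by (force simp: bind_return_pmf subst_kernel_def)
    ultimately obtain p' s' where "p' @ w @ s' \<in> set_pmf (subst_iter P 1 x)"
      using subst_iter_factor by blast
    with x(1) have y: "p' @ w @ s' \<in> set_pmf (subst_iter P (1 + k) [c])"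
      unfolding subst_iter_add set_bind_pmf by blast
    have fin: "finite (set_pmf (subst_iter P (1 + k) [c]))" by (rule finite_subst_iter[OF rs])
    have "0 < measure_pmf.expectation (subst_iter P (1 + k) [c]) (\<lambda>y. 1 - 1 / real (length y))"
      by (rule expectation_pos[OF fin _ y]) (use w(2) in \<open>auto simp: divide_le_eq_1 Suc_le_eq\<close>)
    also have "\<dots> = 1 - inv_length P (1 + k) [c]"
      unfolding inv_length_def
      by (subst Bochner_Integration.integral_diff)
        (simp_all add: integrable_measure_pmf_finite finite_subst_iter[OF rs] del: subst_iter.simps)
    finally show ?thesis by simp
  qed
  then have G: "Max (range (\<lambda>c. inv_length P (1 + k) [c])) < 1"
    by (subst Max_less_iff) auto
  show ?thesis
  proof (rule summable_geometric_steps[OF inv_length_nonneg _ G])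
    fix n
    show "inv_length P (n + (1 + k)) [a] \<le> Max (range (\<lambda>c. inv_length P (1 + k) [c])) * inv_length P n [a]"
      unfolding add.commute[of n] by (rule inv_length_add) (auto intro: Max_ge)
  qed
qed

lemma length_letter_image_bounded: "\<exists>K. \<forall>a. \<forall>w\<in>set_pmf (P a). length w \<le> K"
proof -
  have "finite (\<Union>a. length ` set_pmf (P a))" using rs by (auto simp: random_substitution_def)
  then show ?thesis unfolding finite_nat_set_iff_bounded_le by blast
qed

end

section \<open>Second moment of the number of occurrences\<close>

text \<open>For \<open>x\<close> at least as long as \<open>u\<close>: the expected number of
  occurrences of \<open>u\<close> starting in the image of the first letter of \<open>x\<close>. The
  value 0 for shorter \<open>x\<close> matches \<open>occ\<close>, which counts no windows
  there.\<close>

definition window_weight :: "('a \<Rightarrow> 'a list pmf) \<Rightarrow> 'a list \<Rightarrow> 'a list \<Rightarrow> real" where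
  "window_weight P u x = (if length u \<le> length x then induced_matrix P (length u) u (take (length u) x) else 0)"

text \<open>For legal \<open>x\<close> this is the coordinate \<open>u\<close> of
  \<open>F (n + 1) - A (F n)\<close>. Writing it by positions of \<open>x\<close> instead of legal
  words lets letters be peeled off one at a time.\<close>

definition occ_deviation :: "('a \<Rightarrow> 'a list pmf) \<Rightarrow> 'a list \<Rightarrow> 'a list \<Rightarrow> 'a list \<Rightarrow> real" where
  "occ_deviation P u x y = real (occ u y) - (\<Sum>j<length x. window_weight P u (drop j x))"

lemma occ_deviation_Cons:
  assumes "u \<noteq> []"
  shows "occ_deviation P u (a # x) (concat (w # ws))
       = (real (win_count u w (concat ws)) - window_weight P u (a # x)) + occ_deviation P u x (concat ws)"
  using assms by (simp add: occ_deviation_def occ_append sum.lessThan_Suc_shift del: sum.lessThan_Suc)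

context
  fixes P :: "'a::finite \<Rightarrow> 'a list pmf" and u :: "'a list" and K :: nat
  assumes rs: "random_substitution P" and u: "u \<noteq> []"
    and K: "\<And>a w. w \<in> set_pmf (P a) \<Longrightarrow> length w \<le> K"
begin

lemma window_weight_bounds: "0 \<le> window_weight P u x" "window_weight P u x \<le> K"
proof -
  show "0 \<le> window_weight P u x" by (simp add: window_weight_def induced_matrix_nonneg)
  have "induced_matrix P (length u) u v \<le> K" if v: "v \<noteq> []" for v
  proof -
    have "induced_matrix P (length u) u v \<le> measure_pmf.expectation (subst_blocks P v) (\<lambda>_. real K)"
      unfolding induced_matrix_eq[OF refl v]
    proof (rule expectation_mono_finite[OF finite_subst_blocks[OF rs]])
      fix ws assume "ws \<in> set_pmf (subst_blocks P v)"
      with v have "length (hd ws) \<le> K"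
        by (cases ws; cases v) (auto simp: set_pmf_subst_blocks K)
      with win_count_le[of u "hd ws" "concat (tl ws)"]
      show "real (win_count u (hd ws) (concat (tl ws))) \<le> real K" by simp
    qed
    then show ?thesis by simp
  qed
  moreover have "take (length u) x \<noteq> []" if "length u \<le> length x" using u that by auto
  ultimately show "window_weight P u x \<le> K" by (simp add: window_weight_def)
qed

lemma win_deviation_bound:
  assumes "w \<in> set_pmf (P a)"
  shows "\<bar>real (win_count u w r) - window_weight P u x\<bar> \<le> K"
  using window_weight_bounds[of x] win_count_le[of u w r] K[OF assms] by linarith

text \<open>Each letter removed from the front changes the deviation by one centred-type term of
  size at most \<open>K\<close>. With an empty remainder this is also the crude bound on the
  deviation itself.\<close>

lemma occ_deviation_append_bound:
  assumes "ws \<in> set_pmf (subst_blocks P y)"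
  shows "\<bar>occ_deviation P u (y @ z) (concat (ws @ vs)) - occ_deviation P u z (concat vs)\<bar> \<le> K * length y"
  using assms
proof (induction y arbitrary: ws)
  case Nil
  then show ?case by simp
next
  case (Cons a y)
  then obtain w ws' where ws: "ws = w # ws'" "w \<in> set_pmf (P a)" "ws' \<in> set_pmf (subst_blocks P y)"
    by auto
  have "occ_deviation P u ((a # y) @ z) (concat (ws @ vs))
      = (real (win_count u w (concat (ws' @ vs))) - window_weight P u (a # y @ z))
        + occ_deviation P u (y @ z) (concat (ws' @ vs))"
    using occ_deviation_Cons[OF u, of P a "y @ z" w "ws' @ vs"] by (simp add: ws(1))
  then show ?case
    using win_deviation_bound[OF ws(2), of "concat (ws' @ vs)" "a # y @ z"] Cons.IH[OF ws(3)]
    by (simp add: algebra_simps abs_le_iff)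
qed

text \<open>The factor \<open>g\<close> reads only the images of the first \<open>length u\<close>
  letters. Dropping the letters after \<open>a\<close> that it reads changes the other factor by a
  bounded amount and makes it independent of \<open>g\<close>, which has mean zero; only the cost of
  dropping remains.\<close>

lemma occ_deviation_cross_term:
  fixes a :: 'a and x :: "'a list"
  defines "g \<equiv> \<lambda>ws. real (win_count u (hd ws) (concat (tl ws))) - window_weight P u (a # x)"
  shows "measure_pmf.expectation (subst_blocks P (a # x)) (\<lambda>ws. g ws * occ_deviation P u x (concat (tl ws)))
     \<le> (real K)\<^sup>2 * length u"
proof (cases "length x < length u - 1")
  \<comment> \<open>Here \<open>a # x\<close> is shorter than \<open>u\<close>, the weight is 0 and
    \<open>g\<close> need not be centred, but the word is so short that crude bounds on both factors
    do.\<close>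
  case True
  have "measure_pmf.expectation (subst_blocks P (a # x)) (\<lambda>ws. g ws * occ_deviation P u x (concat (tl ws)))
      \<le> measure_pmf.expectation (subst_blocks P (a # x)) (\<lambda>_. (real K)\<^sup>2 * length u)"
  proof (rule expectation_mono_finite[OF finite_subst_blocks[OF rs]])
    fix ws assume "ws \<in> set_pmf (subst_blocks P (a # x))"
    then obtain w ws' where ws: "ws = w # ws'" "w \<in> set_pmf (P a)" "ws' \<in> set_pmf (subst_blocks P x)"
      by auto
    have "\<bar>g ws\<bar> \<le> K" using win_deviation_bound[OF ws(2)] by (simp add: g_def ws(1))
    moreover have "\<bar>occ_deviation P u x (concat ws')\<bar> \<le> K * length x"
      using occ_deviation_append_bound[OF ws(3), of "[]" "[]"] u by (simp add: occ_deviation_def)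
    ultimately have "\<bar>g ws\<bar> * \<bar>occ_deviation P u x (concat ws')\<bar> \<le> real K * (K * length x)"
      by (intro mult_mono) auto
    also have "\<dots> \<le> real K * (real K * length u)"
      using True by (simp add: mult_left_mono)
    finally show "g ws * occ_deviation P u x (concat (tl ws)) \<le> (real K)\<^sup>2 * length u"
      by (simp add: ws(1) power2_eq_square abs_mult[symmetric] mult.assoc)
  qed
  then show ?thesis by simp
next
  case False
  define y z where "y = take (length u - 1) x" and "z = drop (length u - 1) x"
  have x: "x = y @ z" by (simp add: y_def z_def)
  have y: "length y = length u - 1" using False by (simp add: y_def)
  have ul: "length u = Suc (length y)" using u y by simp
  let ?T = "subst_blocks P (a # y)" and ?Z = "subst_blocks P z"
  let ?D = "\<lambda>vs. occ_deviation P u z (concat vs)"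
  have fin: "finite (set_pmf (pair_pmf ?T ?Z))" by (simp add: finite_subst_blocks[OF rs] del: subst_blocks.simps)
  \<comment> \<open>The weight depends only on \<open>a # y\<close>, whose length is exactly
    \<open>length u\<close>, and equals the mean of the window count by the formula for the induced
    matrix.\<close>
  have T0: "measure_pmf.expectation ?T g = 0"
  proof -
    have "measure_pmf.expectation ?T g
        = measure_pmf.expectation ?T (\<lambda>ws. real (win_count u (hd ws) (concat (tl ws)))) - window_weight P u (a # x)"
      unfolding g_def
      by (subst Bochner_Integration.integral_diff)
        (simp_all add: integrable_measure_pmf_finite[OF finite_subst_blocks[OF rs]] del: subst_blocks.simps)
    also have "window_weight P u (a # x) = induced_matrix P (length u) u (a # y)"
      using ul by (simp add: window_weight_def x)
    finally show ?thesis using induced_matrix_eq[of u "length u" "a # y" P] by simp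
  qed
  have "measure_pmf.expectation (subst_blocks P (a # x)) (\<lambda>ws. g ws * occ_deviation P u x (concat (tl ws)))
      = measure_pmf.expectation (pair_pmf ?T ?Z)
          (\<lambda>q. g (fst q @ snd q) * occ_deviation P u x (concat (tl (fst q @ snd q))))"
    using subst_blocks_append[of P "a # y" z] by (simp add: x case_prod_unfold del: subst_blocks.simps)
  also have "\<dots> \<le> measure_pmf.expectation (pair_pmf ?T ?Z)
          (\<lambda>q. (real K)\<^sup>2 * length u + g (fst q) * ?D (snd q))"
  proof (rule expectation_mono_finite[OF fin])
    fix q assume "q \<in> set_pmf (pair_pmf ?T ?Z)"
    then obtain w ws vs where q: "q = (w # ws, vs)" "w \<in> set_pmf (P a)"
        "ws \<in> set_pmf (subst_blocks P y)" "vs \<in> set_pmf ?Z" by auto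
    \<comment> \<open>Images are non-empty, so those of \<open>y\<close> already fill the range that
      windows starting in \<open>w\<close> can read, and \<open>vs\<close> has no influence on
      \<open>g\<close>.\<close>
    have "length u - 1 \<le> length (concat ws)"
      using length_le_concat[OF subst_blocks_nonempty[OF rs q(3)]] length_subst_blocks[OF rs q(3)] y by simp
    then have "take (length u - 1) (concat (ws @ vs)) = take (length u - 1) (concat ws)" by simp
    then have "win_count u w (concat (ws @ vs)) = win_count u w (concat ws)"
      by (metis win_count_take[OF u])
    then have g: "g (fst q @ snd q) = g (fst q)" by (simp add: g_def q(1))
    have "\<bar>g (fst q)\<bar> \<le> K" using win_deviation_bound[OF q(2)] by (simp add: g_def q(1))
    moreover have "\<bar>occ_deviation P u x (concat (ws @ vs)) - ?D vs\<bar> \<le> K * length y"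
      unfolding x by (rule occ_deviation_append_bound[OF q(3)])
    ultimately have "\<bar>g (fst q)\<bar> * \<bar>occ_deviation P u x (concat (ws @ vs)) - ?D vs\<bar> \<le> real K * (K * length y)"
      by (intro mult_mono) auto
    also have "\<dots> \<le> (real K)\<^sup>2 * length u"
      using ul by (simp add: power2_eq_square algebra_simps)
    finally have "g (fst q) * (occ_deviation P u x (concat (ws @ vs)) - ?D vs) \<le> (real K)\<^sup>2 * length u"
      by (simp only: abs_mult[symmetric] abs_le_iff)
    then have "g (fst q) * occ_deviation P u x (concat (ws @ vs)) \<le> (real K)\<^sup>2 * length u + g (fst q) * ?D vs"
      by (simp only: right_diff_distrib)
    then show "g (fst q @ snd q) * occ_deviation P u x (concat (tl (fst q @ snd q)))
        \<le> (real K)\<^sup>2 * length u + g (fst q) * ?D (snd q)"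
      unfolding g by (simp only: q(1) fst_conv snd_conv append_Cons list.sel)
  qed
  also have "\<dots> = (real K)\<^sup>2 * length u + measure_pmf.expectation ?T g * measure_pmf.expectation ?Z ?D"
  proof -
    have "measure_pmf.expectation (pair_pmf ?T ?Z) (\<lambda>q. g (fst q) * ?D (snd q))
        = measure_pmf.expectation ?T g * measure_pmf.expectation ?Z ?D"
      by (intro expectation_pair_mult finite_subst_blocks[OF rs])
    then show ?thesis
      by (subst Bochner_Integration.integral_add)
        (simp_all add: integrable_measure_pmf_finite[OF fin] del: subst_blocks.simps)
  qed
  finally show ?thesis by (simp add: T0 del: subst_blocks.simps)
qed

text \<open>The images of far apart letters are independent and the windows starting in the image of one
  letter only see the next \<open>length u - 1\<close> letters, so the variance grows linearly.\<close>

lemma occ_deviation_second_moment: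
  "measure_pmf.expectation (subst_kernel P x) (\<lambda>y. (occ_deviation P u x y)\<^sup>2)
     \<le> (1 + 2 * real (length u)) * (real K)\<^sup>2 * length x"
proof -
  have "measure_pmf.expectation (subst_blocks P x) (\<lambda>ws. (occ_deviation P u x (concat ws))\<^sup>2)
     \<le> (1 + 2 * real (length u)) * (real K)\<^sup>2 * length x"
  proof (induction x)
    case Nil
    then show ?case using u by (simp add: occ_deviation_def)
  next
    case (Cons a x)
    let ?B = "subst_blocks P (a # x)"
    define g where "g = (\<lambda>ws. real (win_count u (hd ws) (concat (tl ws))) - window_weight P u (a # x))"
    define D where "D = (\<lambda>ws. occ_deviation P u x (concat ws))"
    have fin: "finite (set_pmf ?B)" by (rule finite_subst_blocks[OF rs])
    \<comment> \<open>Expanding the square of \<open>g + D\<close>, one letter costs at most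
      \<open>K\<^sup>2\<close> for the square of \<open>g\<close> and twice
      \<open>K\<^sup>2 * length u\<close> for the cross term; this is the constant in the
      statement.\<close>
    have "measure_pmf.expectation ?B (\<lambda>ws. (occ_deviation P u (a # x) (concat ws))\<^sup>2)
        \<le> measure_pmf.expectation ?B (\<lambda>ws. ((real K)\<^sup>2 + 2 * (g ws * D (tl ws))) + (D (tl ws))\<^sup>2)"
    proof (rule expectation_mono_finite[OF fin])
      fix ws assume "ws \<in> set_pmf ?B"
      then obtain w ws' where ws: "ws = w # ws'" "w \<in> set_pmf (P a)" by auto
      have "\<bar>g ws\<bar> \<le> K" using win_deviation_bound[OF ws(2)] by (simp add: g_def ws(1))
      then have "(g ws)\<^sup>2 \<le> (real K)\<^sup>2" by (simp add: abs_le_square_iff[symmetric])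
      moreover have "occ_deviation P u (a # x) (concat ws) = g ws + D (tl ws)"
        using occ_deviation_Cons[OF u, of P a x w ws'] by (simp add: ws(1) g_def D_def)
      ultimately show "(occ_deviation P u (a # x) (concat ws))\<^sup>2
          \<le> ((real K)\<^sup>2 + 2 * (g ws * D (tl ws))) + (D (tl ws))\<^sup>2"
        by (simp add: power2_sum)
    qed
    also have "\<dots> = (real K)\<^sup>2 + 2 * measure_pmf.expectation ?B (\<lambda>ws. g ws * D (tl ws))
        + measure_pmf.expectation ?B (\<lambda>ws. (D (tl ws))\<^sup>2)"
      by (simp add: Bochner_Integration.integral_add integrable_measure_pmf_finite[OF fin] del: subst_blocks.simps)
    also have "measure_pmf.expectation ?B (\<lambda>ws. g ws * D (tl ws)) \<le> (real K)\<^sup>2 * length u"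
      unfolding g_def D_def by (rule occ_deviation_cross_term)
    also have "measure_pmf.expectation ?B (\<lambda>ws. (D (tl ws))\<^sup>2)
        = measure_pmf.expectation (subst_blocks P x) (\<lambda>ws. (D ws)\<^sup>2)"
      unfolding map_tl_subst_blocks[of P a x, symmetric] integral_map_pmf ..
    also have "\<dots> \<le> (1 + 2 * real (length u)) * (real K)\<^sup>2 * length x"
      unfolding D_def by (rule Cons.IH)
    finally show ?case by (simp add: algebra_simps)
  qed
  then show ?thesis by (simp add: subst_kernel_def)
qed

end

section \<open>One-step laws of the chain\<close>

text \<open>The definition of a chain speaks of complete histories only. There are countably many
  histories ending in \<open>x\<close>, and the transition factor is the same for all of them, so
  summation yields the one-step law.\<close>

lemma subst_chain_step:
  fixes X :: "nat \<Rightarrow> 'w \<Rightarrow> 'a::finite list"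
  assumes "subst_chain P u M X"
  shows "emeasure M {\<omega> \<in> space M. X n \<omega> = x \<and> X (Suc n) \<omega> = y}
       = emeasure M {\<omega> \<in> space M. X n \<omega> = x} * ennreal (pmf (subst_kernel P x) y)"
proof -
  interpret prob_space M using assms by (simp add: subst_chain_def)
  have [measurable]: "X i \<in> measurable M (count_space UNIV)" for i
    using assms by (simp add: subst_chain_def)
  define I where "I = {h. length h = Suc n \<and> h ! n = x}"
  define E where "E h = {\<omega> \<in> space M. \<forall>i\<le>n. X i \<omega> = h ! i}" for h
  define E' where "E' h = {\<omega> \<in> space M. \<forall>i\<le>Suc n. X i \<omega> = (h @ [y]) ! i}" for h
  have I: "countable I" by (rule countable_subset[OF subset_UNIV]) simp
  have h_eq: "h = map (\<lambda>i. X i \<omega>) [0..<Suc n]" if "h \<in> I" "\<forall>i\<le>n. X i \<omega> = h ! i" for h \<omega>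
    using that by (intro nth_equalityI) (auto simp: I_def simp del: upt_Suc)
  have E'_sub: "E' h \<subseteq> E h" if "h \<in> I" for h
    using that by (auto simp: E_def E'_def I_def nth_append)
  have disj: "disjoint_family_on E I"
    unfolding disjoint_family_on_def E_def using h_eq by blast
  then have disj': "disjoint_family_on E' I"
    unfolding disjoint_family_on_def using E'_sub by blast
  have hist: "map (\<lambda>i. X i \<omega>) [0..<Suc n] \<in> I" if "X n \<omega> = x" for \<omega>
    using that by (auto simp: I_def simp del: upt_Suc)
  have nth_hist: "map (\<lambda>i. X i \<omega>) [0..<Suc n] ! i = X i \<omega>" if "i \<le> n" for i \<omega>
    using that by (simp del: upt_Suc)
  have UE: "(\<Union>h\<in>I. E h) = {\<omega> \<in> space M. X n \<omega> = x}"
  proof (intro set_eqI iffI)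
    fix \<omega> assume "\<omega> \<in> {\<omega> \<in> space M. X n \<omega> = x}"
    then have "map (\<lambda>i. X i \<omega>) [0..<Suc n] \<in> I" "\<omega> \<in> E (map (\<lambda>i. X i \<omega>) [0..<Suc n])"
      using hist nth_hist by (auto simp: E_def simp del: upt_Suc)
    then show "\<omega> \<in> (\<Union>h\<in>I. E h)" by blast
  qed (auto simp: E_def I_def)
  have UE': "(\<Union>h\<in>I. E' h) = {\<omega> \<in> space M. X n \<omega> = x \<and> X (Suc n) \<omega> = y}"
  proof (intro set_eqI iffI)
    fix \<omega> assume \<omega>: "\<omega> \<in> {\<omega> \<in> space M. X n \<omega> = x \<and> X (Suc n) \<omega> = y}"
    then have "\<omega> \<in> E' (map (\<lambda>i. X i \<omega>) [0..<Suc n])"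
      using nth_hist by (auto simp: E'_def nth_append less_Suc_eq_le le_Suc_eq simp del: upt_Suc)
    with \<omega> hist show "\<omega> \<in> (\<Union>h\<in>I. E' h)" by blast
  next
    fix \<omega> assume "\<omega> \<in> (\<Union>h\<in>I. E' h)"
    then obtain h where h: "h \<in> I" "\<omega> \<in> E' h" by blast
    then have "\<omega> \<in> space M" "X n \<omega> = (h @ [y]) ! n" "X (Suc n) \<omega> = (h @ [y]) ! Suc n"
      by (auto simp: E'_def)
    with h(1) show "\<omega> \<in> {\<omega> \<in> space M. X n \<omega> = x \<and> X (Suc n) \<omega> = y}"
      by (auto simp: I_def nth_append)
  qed
  have step: "emeasure M (E' h) = emeasure M (E h) * ennreal (pmf (subst_kernel P x) y)" if h: "h \<in> I" for h
  proof -
    have "measure M (E' h) = measure M {\<omega> \<in> space M. \<forall>i\<le>n. X i \<omega> = (h @ [y]) ! i}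
        * pmf (subst_kernel P ((h @ [y]) ! n)) ((h @ [y]) ! Suc n)"
      using assms unfolding subst_chain_def E'_def by blast
    moreover have "{\<omega> \<in> space M. \<forall>i\<le>n. X i \<omega> = (h @ [y]) ! i} = E h"
      using h by (auto simp: E_def I_def nth_append)
    ultimately have "measure M (E' h) = measure M (E h) * pmf (subst_kernel P x) y"
      using h by (simp add: I_def nth_append)
    then show ?thesis by (simp add: emeasure_eq_measure ennreal_mult)
  qed
  have [measurable]: "E h \<in> sets M" "E' h \<in> sets M" for h
    unfolding E_def E'_def by measurable
  have "emeasure M (\<Union>h\<in>I. E' h) = (\<integral>\<^sup>+h. emeasure M (E' h) \<partial>count_space I)"
    by (rule emeasure_UN_countable[OF _ I disj']) simp
  also have "\<dots> = (\<integral>\<^sup>+h. emeasure M (E h) * ennreal (pmf (subst_kernel P x) y) \<partial>count_space I)"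
    by (rule nn_integral_cong) (simp add: step)
  also have "\<dots> = (\<integral>\<^sup>+h. emeasure M (E h) \<partial>count_space I) * ennreal (pmf (subst_kernel P x) y)"
    by (rule nn_integral_multc) simp
  also have "(\<integral>\<^sup>+h. emeasure M (E h) \<partial>count_space I) = emeasure M (\<Union>h\<in>I. E h)"
    by (rule emeasure_UN_countable[OF _ I disj, symmetric]) simp
  finally show ?thesis unfolding UE UE' .
qed

lemma subst_chain_marginal:
  fixes X :: "nat \<Rightarrow> 'w \<Rightarrow> 'a::finite list"
  assumes "subst_chain P u M X"
  shows "emeasure M {\<omega> \<in> space M. X n \<omega> = x} = ennreal (pmf (subst_iter P n u) x)"
proof (induction n arbitrary: x)
  case 0
  interpret prob_space M using assms by (simp add: subst_chain_def)
  have [measurable]: "X 0 \<in> measurable M (count_space UNIV)" and AE0: "AE \<omega> in M. X 0 \<omega> = u"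
    using assms by (auto simp: subst_chain_def)
  have "emeasure M {\<omega> \<in> space M. X 0 \<omega> = x} = emeasure M (if x = u then space M else {})"
    by (rule emeasure_eq_AE) (use AE0 in auto)
  then show ?case by (simp add: emeasure_space_1)
next
  case (Suc n)
  have [measurable]: "X i \<in> measurable M (count_space UNIV)" for i
    using assms by (simp add: subst_chain_def)
  have "{\<omega> \<in> space M. X (Suc n) \<omega> = x} = (\<Union>z. {\<omega> \<in> space M. X n \<omega> = z \<and> X (Suc n) \<omega> = x})"
    by auto
  then have "emeasure M {\<omega> \<in> space M. X (Suc n) \<omega> = x}
      = (\<integral>\<^sup>+z. emeasure M {\<omega> \<in> space M. X n \<omega> = z \<and> X (Suc n) \<omega> = x} \<partial>count_space UNIV)"
    by (simp only:) (rule emeasure_UN_countable; auto simp: disjoint_family_on_def)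
  also have "\<dots> = (\<integral>\<^sup>+z. ennreal (pmf (subst_iter P n u) z) * ennreal (pmf (subst_kernel P z) x) \<partial>count_space UNIV)"
    by (simp add: subst_chain_step[OF assms] Suc)
  also have "\<dots> = ennreal (pmf (subst_iter P (Suc n) u) x)"
    by (simp add: ennreal_pmf_bind nn_integral_measure_pmf)
  finally show ?case .
qed

text \<open>Carries expectations and almost sure statements about two consecutive words from the
  arbitrary space \<open>M\<close> to a finitely supported law.\<close>

lemma distr_subst_chain_pair:
  fixes X :: "nat \<Rightarrow> 'w \<Rightarrow> 'a::finite list"
  assumes "subst_chain P u M X"
  shows "distr M (count_space UNIV) (\<lambda>\<omega>. (X n \<omega>, X (Suc n) \<omega>))
       = measure_pmf (bind_pmf (subst_iter P n u) (\<lambda>x. map_pmf (Pair x) (subst_kernel P x)))"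
proof (rule measure_eqI_countable)
  have X[measurable]: "X i \<in> measurable M (count_space UNIV)" for i
    using assms by (simp add: subst_chain_def)
  have m: "(\<lambda>\<omega>. (X n \<omega>, X (Suc n) \<omega>)) \<in> measurable M (count_space UNIV)"
    by (rule measurable_compose_countable'[where f = "\<lambda>x \<omega>. (x, X (Suc n) \<omega>)" and I = UNIV, OF _ X]) auto
  fix p :: "'a list \<times> 'a list" assume "p \<in> UNIV"
  obtain x y where p: "p = (x, y)" by (cases p)
  let ?p = "subst_iter P n u" and ?K = "subst_kernel P"
  have inj: "inj (Pair z :: 'a list \<Rightarrow> _)" for z :: "'a list" by (auto simp: inj_def)
  have "pmf (map_pmf (Pair z) (?K z)) (x, y) = pmf (?K x) y * indicator {x} z" for z
  proof (cases "z = x")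
    case True
    then show ?thesis using pmf_map_inj'[OF inj, of z "?K z" y] by simp
  next
    case False
    then have "(x, y) \<notin> set_pmf (map_pmf (Pair z) (?K z))" by auto
    with False show ?thesis unfolding set_pmf_iff by simp
  qed
  then have "ennreal (pmf (bind_pmf ?p (\<lambda>x. map_pmf (Pair x) (?K x))) (x, y))
      = (\<integral>\<^sup>+z. ennreal (pmf (?K x) y) * indicator {x} z \<partial>measure_pmf ?p)"
    by (simp add: ennreal_pmf_bind ennreal_mult'' ennreal_indicator)
  also have "\<dots> = ennreal (pmf (?K x) y) * ennreal (pmf ?p x)"
    by (subst nn_integral_cmult_indicator) (simp_all add: emeasure_pmf_single)
  also have "\<dots> = emeasure M {\<omega> \<in> space M. X n \<omega> = x \<and> X (Suc n) \<omega> = y}"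
    by (simp add: subst_chain_step[OF assms] subst_chain_marginal[OF assms] mult.commute)
  also have "\<dots> = emeasure (distr M (count_space UNIV) (\<lambda>\<omega>. (X n \<omega>, X (Suc n) \<omega>))) {(x, y)}"
    by (subst emeasure_distr[OF m]) (auto intro!: arg_cong[where f = "emeasure M"])
  finally show "emeasure (distr M (count_space UNIV) (\<lambda>\<omega>. (X n \<omega>, X (Suc n) \<omega>))) {p}
      = emeasure (measure_pmf (bind_pmf ?p (\<lambda>x. map_pmf (Pair x) (?K x)))) {p}"
    by (simp add: p emeasure_pmf_single)
qed auto

text \<open>The expected sum of the series is finite, so the series converges almost surely and its
  terms tend to 0.\<close>

lemma AE_tendsto_0_of_summable:
  fixes f :: "nat \<Rightarrow> 'w \<Rightarrow> real"
  assumes [measurable]: "\<And>n. f n \<in> borel_measurable M" and f: "\<And>n \<omega>. 0 \<le> f n \<omega>"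
    and le: "\<And>n. (\<integral>\<^sup>+\<omega>. ennreal (f n \<omega>) \<partial>M) \<le> ennreal (c n)"
    and c: "summable c" "\<And>n. 0 \<le> c n"
  shows "AE \<omega> in M. (\<lambda>n. f n \<omega>) \<longlonglongrightarrow> 0"
proof -
  have "(\<integral>\<^sup>+\<omega>. (\<Sum>n. ennreal (f n \<omega>)) \<partial>M) = (\<Sum>n. \<integral>\<^sup>+\<omega>. ennreal (f n \<omega>) \<partial>M)"
    by (rule nn_integral_suminf) simp
  also have "\<dots> \<le> (\<Sum>n. ennreal (c n))" by (intro suminf_le le) auto
  also have "\<dots> = ennreal (\<Sum>n. c n)" by (rule suminf_ennreal2) (use c in auto)
  finally have "(\<integral>\<^sup>+\<omega>. (\<Sum>n. ennreal (f n \<omega>)) \<partial>M) \<noteq> \<infinity>"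
    by (metis ennreal_neq_top infinity_ennreal_def neq_top_trans)
  then have "AE \<omega> in M. (\<Sum>n. ennreal (f n \<omega>)) \<noteq> \<infinity>"
    by (intro nn_integral_PInf_AE) auto
  then show ?thesis
  proof eventually_elim
    case (elim \<omega>)
    then have "summable (\<lambda>n. f n \<omega>)" using f by (intro summable_suminf_not_top) auto
    then show ?case by (rule summable_LIMSEQ_zero)
  qed
qed

section \<open>Almost sure convergence of frequencies\<close>

lemma length_subst_kernel_le:
  assumes "\<And>a w. w \<in> set_pmf (P a) \<Longrightarrow> length w \<le> K" "y \<in> set_pmf (subst_kernel P x)"
  shows "length y \<le> K * length x"
proof -
  have "length (concat ws) \<le> K * length x" if "ws \<in> set_pmf (subst_blocks P x)" for ws
    using that
  proof (induction x arbitrary: ws)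
    case (Cons b x)
    then obtain w ws' where "ws = w # ws'" "w \<in> set_pmf (P b)" "ws' \<in> set_pmf (subst_blocks P x)"
      by auto
    with Cons.IH[of ws'] assms(1)[of w b] show ?case by simp
  qed simp
  then show ?thesis using assms(2) by (auto simp: subst_kernel_def)
qed

section \<open>Counting windows of legal words\<close>

lemma legal_window:
  assumes "x \<in> legal_words P" "0 < l"
  shows "take l (drop j x) \<in> legal_words_of_length P l \<longleftrightarrow> j + l \<le> length x"
proof
  assume "j + l \<le> length x"
  then have len: "length (take l (drop j x)) = l" by simp
  have "x = take j x @ take l (drop j x) @ drop l (drop j x)" by (simp only: append_take_drop_id)
  then have "take l (drop j x) \<in> legal_words P"
    using legal_words_factor assms len by (metis length_greater_0_conv)
  then show "take l (drop j x) \<in> legal_words_of_length P l"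
    using len by (simp add: legal_words_of_length_def)
next
  assume "take l (drop j x) \<in> legal_words_of_length P l"
  then show "j + l \<le> length x" using assms(2) by (auto simp: legal_words_of_length_def)
qed

text \<open>Double counting by starting position; all full windows of a legal word are legal, so
  none is missed. The weight \<open>c\<close> is a row of the induced matrix in one application and
  constantly 1 in the other.\<close>

lemma sum_occ_legal:
  fixes P :: "'a::finite \<Rightarrow> 'a list pmf"
  assumes x: "x \<in> legal_words P" and l: "0 < l"
  shows "(\<Sum>v\<in>legal_words_of_length P l. c v * real (occ v x))
       = (\<Sum>j<length x. if j + l \<le> length x then c (take l (drop j x)) else 0)"
proof -
  let ?S = "legal_words_of_length P l"
  have S: "v \<noteq> []" "length v = l" if "v \<in> ?S" for v
    using that by (auto simp: legal_words_of_length_def legal_words_iff)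
  have "(\<Sum>v\<in>?S. c v * real (occ v x)) = (\<Sum>v\<in>?S. \<Sum>j<length x. c v * of_bool (take l (drop j x) = v))"
    by (intro sum.cong refl)
      (simp add: occ_eq_sum S sum_distrib_left of_nat_sum of_nat_of_bool del: sum_of_bool_eq)
  also have "\<dots> = (\<Sum>j<length x. \<Sum>v\<in>?S. c v * of_bool (take l (drop j x) = v))"
    by (rule sum.swap)
  also have "\<dots> = (\<Sum>j<length x. if j + l \<le> length x then c (take l (drop j x)) else 0)"
    using legal_window[OF x l]
    by (intro sum.cong refl)
      (simp add: of_bool_def if_distrib[of "\<lambda>b. _ * b"] finite_legal_words_of_length cong: if_cong)
  finally show ?thesis .
qed

lemma occ_deviation_legal:
  fixes P :: "'a::finite \<Rightarrow> 'a list pmf"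
  assumes x: "x \<in> legal_words P" and l: "0 < l" "length u = l"
  shows "occ_deviation P u x y
       = real (occ u y) - (\<Sum>v\<in>legal_words_of_length P l. induced_matrix P l u v * real (occ v x))"
  unfolding occ_deviation_def sum_occ_legal[OF x l(1)] window_weight_def
  by (intro arg_cong2[of _ _ _ _ "(-)"] sum.cong refl) (auto simp: l(2))

lemma total_occ_legal:
  fixes P :: "'a::finite \<Rightarrow> 'a list pmf"
  assumes x: "x \<in> legal_words P" and l: "0 < l"
  shows "\<bar>(\<Sum>v\<in>legal_words_of_length P l. real (occ v x)) - real (length x)\<bar> \<le> l"
proof -
  have "(\<Sum>v\<in>legal_words_of_length P l. real (occ v x)) = (\<Sum>j<length x. if j + l \<le> length x then 1 else 0)"
    using sum_occ_legal[OF x l, of "\<lambda>_. 1"] by simp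
  also have "\<dots> = real (card {j \<in> {..<length x}. j + l \<le> length x})"
    by (simp add: sum.inter_filter[symmetric])
  \<comment> \<open>Truncated subtraction also covers words shorter than \<open>l\<close>, which
    have no window at all.\<close>
  also have "{j \<in> {..<length x}. j + l \<le> length x} = {..<Suc (length x) - l}" using l by auto
  finally show ?thesis using l by (simp add: abs_le_iff)
qed

theorem proposition4p3:
  fixes P :: "'a::finite \<Rightarrow> 'a list pmf"
    and l :: nat and v :: "'a list" and a :: 'a
    and M :: "'w measure" and X :: "nat \<Rightarrow> 'w \<Rightarrow> 'a list"
  assumes "random_substitution P"
    and "primitive_substitution P"
    and "expanding_substitution P"
    and "v \<in> legal_words_of_length P l"
    and "subst_chain P [a] M X"
  shows "AE \<omega> in M. (\<lambda>n. real (occ v (X n \<omega>)) / real (length (X n \<omega>)))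
           \<longlonglongrightarrow> pf_right_eigenvector (legal_words_of_length P l) (induced_matrix P l) v"
proof -
  define S where "S = legal_words_of_length P l"
  define A where "A = induced_matrix P l"
  note rs = assms(1)
  have fin: "finite S" and ne: "S \<noteq> {}" and prim: "primitive_matrix S A"
    using assms finite_legal_words_of_length induced_matrix_primitive by (auto simp: S_def A_def)
  obtain k where pos: "\<And>i j. i \<in> S \<Longrightarrow> j \<in> S \<Longrightarrow> 0 < mat_pow_on S A k i j"
    using prim unfolding primitive_matrix_def by blast
  obtain R r where r: "0 < r" and eig: "\<And>i. i \<in> S \<Longrightarrow> (\<Sum>j\<in>S. A i j * R j) = r * R i"
    and R: "\<And>i. i \<in> S \<Longrightarrow> 0 < R i" and norm: "(\<Sum>i\<in>S. R i) = 1"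
    using pf_existence[OF fin ne prim] by blast
  have v: "v \<in> S" using assms(4) by (simp add: S_def)
  have S: "u \<noteq> []" "length u = l" if "u \<in> S" for u
    using that by (auto simp: S_def legal_words_of_length_def legal_words_iff)
  have l: "0 < l" using S[OF v] by auto
  obtain K where K: "\<And>a w. w \<in> set_pmf (P a) \<Longrightarrow> length w \<le> K"
    using length_letter_image_bounded[OF rs] by blast
  have X[measurable]: "X n \<in> measurable M (count_space UNIV)" for n
    using assms(5) by (simp add: subst_chain_def)
  have XX: "(\<lambda>\<omega>. (X n \<omega>, X (Suc n) \<omega>)) \<in> measurable M (count_space UNIV)" for n
    by (rule measurable_compose_countable'[where f = "\<lambda>x \<omega>. (x, X (Suc n) \<omega>)" and I = UNIV, OF _ X]) auto
  define J where "J n = bind_pmf (subst_iter P n [a]) (\<lambda>x. map_pmf (Pair x) (subst_kernel P x))" for n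
  have J: "distr M (count_space UNIV) (\<lambda>\<omega>. (X n \<omega>, X (Suc n) \<omega>)) = measure_pmf (J n)" for n
    unfolding J_def by (rule distr_subst_chain_pair[OF assms(5)])
  have finJ: "finite (set_pmf (J n))" for n
    by (simp add: J_def finite_subst_iter[OF rs] finite_subst_kernel[OF rs])
  \<comment> \<open>Reduces integrals over \<open>M\<close> to iterated finite expectations, where
    the inner one is over a single substitution step and the second-moment bound applies.\<close>
  have nnJ: "(\<integral>\<^sup>+\<omega>. ennreal (f (X n \<omega>) (X (Suc n) \<omega>)) \<partial>M)
      = ennreal (measure_pmf.expectation (subst_iter P n [a]) (\<lambda>x. measure_pmf.expectation (subst_kernel P x) (f x)))"
    if f: "\<And>x y. 0 \<le> f x y" for f n
  proof -
    have "(\<integral>\<^sup>+\<omega>. ennreal (f (X n \<omega>) (X (Suc n) \<omega>)) \<partial>M)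
        = (\<integral>\<^sup>+q. ennreal (f (fst q) (snd q)) \<partial>measure_pmf (J n))"
      unfolding J[symmetric] by (subst nn_integral_distr[OF XX]) auto
    also have "\<dots> = ennreal (measure_pmf.expectation (J n) (\<lambda>q. f (fst q) (snd q)))"
      by (rule nn_integral_eq_integral) (auto simp: f integrable_measure_pmf_finite[OF finJ])
    also have "measure_pmf.expectation (J n) (\<lambda>q. f (fst q) (snd q))
        = measure_pmf.expectation (subst_iter P n [a]) (\<lambda>x. measure_pmf.expectation (subst_kernel P x) (f x))"
      unfolding J_def
      by (subst expectation_bind_finite) (simp_all add: finite_subst_iter[OF rs] finite_subst_kernel[OF rs])
    finally show ?thesis .
  qed
  have supp: "AE \<omega> in M. X n \<omega> \<in> set_pmf (subst_iter P n [a]) \<and> X (Suc n) \<omega> \<in> set_pmf (subst_kernel P (X n \<omega>))" for n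
  proof -
    have "AE q in measure_pmf (J n). fst q \<in> set_pmf (subst_iter P n [a]) \<and> snd q \<in> set_pmf (subst_kernel P (fst q))"
      by (auto simp: AE_measure_pmf_iff J_def)
    from AE_distrD[OF XX this[folded J]] show ?thesis by simp
  qed
  have sumr: "summable (\<lambda>n. inv_length P n [a])" by (rule summable_inv_length[OF rs assms(2,3)])
  have inv0: "AE \<omega> in M. (\<lambda>n. 1 / real (length (X n \<omega>))) \<longlonglongrightarrow> 0"
  proof (rule AE_tendsto_0_of_summable[OF _ _ _ sumr])
    show "(\<integral>\<^sup>+\<omega>. ennreal (1 / real (length (X n \<omega>))) \<partial>M) \<le> ennreal (inv_length P n [a])" for n
      using nnJ[of "\<lambda>x y. 1 / real (length x)" n] by (simp add: inv_length_def)
    show "(\<lambda>\<omega>. 1 / real (length (X n \<omega>))) \<in> borel_measurable M" for n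
      by (rule measurable_compose[OF X]) simp
  qed (simp_all add: inv_length_nonneg)
  have dev0: "AE \<omega> in M. (\<lambda>n. (occ_deviation P u (X n \<omega>) (X (Suc n) \<omega>) / real (length (X n \<omega>)))\<^sup>2) \<longlonglongrightarrow> 0"
    if u: "u \<in> S" for u
  proof -
    define C where "C = (1 + 2 * real (length u)) * (real K)\<^sup>2"
    have C: "0 \<le> C" by (simp add: C_def)
    have bound: "(\<integral>\<^sup>+\<omega>. ennreal ((occ_deviation P u (X n \<omega>) (X (Suc n) \<omega>) / real (length (X n \<omega>)))\<^sup>2) \<partial>M)
        \<le> ennreal (C * inv_length P n [a])" for n
    proof -
      \<comment> \<open>The second moment is linear in the length, so after division by the squared
        length a multiple of the inverse length remains, and its expectations are summable.\<close>
      have "measure_pmf.expectation (subst_iter P n [a]) (\<lambda>x. measure_pmf.expectation (subst_kernel P x)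
            (\<lambda>y. (occ_deviation P u x y / real (length x))\<^sup>2))
          \<le> measure_pmf.expectation (subst_iter P n [a]) (\<lambda>x. C * (1 / real (length x)))"
      proof (rule expectation_mono_finite[OF finite_subst_iter[OF rs]])
        fix x assume "x \<in> set_pmf (subst_iter P n [a])"
        then have x: "0 < real (length x)" using length_subst_iter_ge[OF rs, of x n "[a]"] by auto
        have "measure_pmf.expectation (subst_kernel P x) (\<lambda>y. (occ_deviation P u x y / real (length x))\<^sup>2)
            = measure_pmf.expectation (subst_kernel P x) (\<lambda>y. (occ_deviation P u x y)\<^sup>2) / (real (length x))\<^sup>2"
          by (simp add: power_divide)
        also have "\<dots> \<le> C * length x / (real (length x))\<^sup>2"
          unfolding C_def using occ_deviation_second_moment[where x = x, OF rs S(1)[OF u] K]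
          by (intro divide_right_mono) auto
        also have "\<dots> = C * (1 / real (length x))" using x by (simp add: power2_eq_square)
        finally show "measure_pmf.expectation (subst_kernel P x) (\<lambda>y. (occ_deviation P u x y / real (length x))\<^sup>2)
            \<le> C * (1 / real (length x))" .
      qed
      also have "\<dots> = C * inv_length P n [a]"
        by (simp add: inv_length_def del: times_divide_eq_right)
      finally show ?thesis
        using nnJ[of "\<lambda>x y. (occ_deviation P u x y / real (length x))\<^sup>2" n] by (simp add: ennreal_leI)
    qed
    show ?thesis
    proof (rule AE_tendsto_0_of_summable[OF _ _ bound])
      show "(\<lambda>\<omega>. (occ_deviation P u (X n \<omega>) (X (Suc n) \<omega>) / real (length (X n \<omega>)))\<^sup>2) \<in> borel_measurable M" for n
        using measurable_compose[OF XX, of "\<lambda>q. (occ_deviation P u (fst q) (snd q) / real (length (fst q)))\<^sup>2" borel n]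
        by simp
    qed (use sumr C in \<open>auto intro!: summable_mult mult_nonneg_nonneg inv_length_nonneg\<close>)
  qed
  \<comment> \<open>Countably many times and finitely many legal words give a single null set;
    outside it the argument is pathwise.\<close>
  have "AE \<omega> in M. \<forall>n. X n \<omega> \<in> set_pmf (subst_iter P n [a]) \<and> X (Suc n) \<omega> \<in> set_pmf (subst_kernel P (X n \<omega>))"
    using supp by (simp only: AE_all_countable) blast
  moreover have "AE \<omega> in M. \<forall>u\<in>S. (\<lambda>n. (occ_deviation P u (X n \<omega>) (X (Suc n) \<omega>) / real (length (X n \<omega>)))\<^sup>2) \<longlonglongrightarrow> 0"
    using dev0 fin by (intro AE_finite_allI)
  ultimately show ?thesis
    using inv0
  proof eventually_elim
    case (elim \<omega>)
    define L where "L n = real (length (X n \<omega>))" for n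
    have legal: "X n \<omega> \<in> legal_words P" and len: "1 \<le> length (X n \<omega>)" for n
    proof -
      have "X n \<omega> \<in> set_pmf (subst_iter P n [a])" using elim(1) by blast
      then show "1 \<le> length (X n \<omega>)" using length_subst_iter_ge[OF rs, of "X n \<omega>" n "[a]"] by simp
      then have "X n \<omega> \<noteq> []" by auto
      with \<open>X n \<omega> \<in> set_pmf (subst_iter P n [a])\<close> show "X n \<omega> \<in> legal_words P"
        unfolding legal_words_iff by (metis append_Nil append_Nil2)
    qed
    have "(\<lambda>n. real (occ v (X n \<omega>)) / L n) \<longlonglongrightarrow> R v"
    proof (rule perturbed_power_iteration[OF fin ne pos eig R norm r])
      show "0 < L n" for n using len[of n] unfolding L_def by linarith
      show "L (Suc n) \<le> real K * L n" for n
        using length_subst_kernel_le[of P K "X (Suc n) \<omega>" "X n \<omega>"] K elim(1)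
        unfolding L_def of_nat_mult[symmetric] of_nat_le_iff by blast
      show "(\<lambda>n. (real (occ u (X (Suc n) \<omega>)) - (\<Sum>w\<in>S. A u w * real (occ w (X n \<omega>)))) / L n) \<longlonglongrightarrow> 0"
        if u: "u \<in> S" for u
      proof -
        have "(\<lambda>n. sqrt ((occ_deviation P u (X n \<omega>) (X (Suc n) \<omega>) / real (length (X n \<omega>)))\<^sup>2)) \<longlonglongrightarrow> sqrt 0"
          using elim(2) u by (intro tendsto_real_sqrt) blast
        then have "(\<lambda>n. occ_deviation P u (X n \<omega>) (X (Suc n) \<omega>) / real (length (X n \<omega>))) \<longlonglongrightarrow> 0"
          by (simp only: real_sqrt_abs real_sqrt_zero tendsto_rabs_zero_iff)
        then show ?thesis
          by (simp only: occ_deviation_legal[OF legal l S(2)[OF u]] S_def A_def L_def)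
      qed
      show "(\<lambda>n. (\<Sum>u\<in>S. real (occ u (X n \<omega>))) / L n) \<longlonglongrightarrow> 1"
      proof -
        \<comment> \<open>The number of windows differs from the length by at most \<open>l\<close>,
          which is negligible because the length tends to infinity.\<close>
        have "(\<lambda>n. real l * (1 / L n)) \<longlonglongrightarrow> 0"
          using elim(3) unfolding L_def by (rule tendsto_mult_right_zero)
        then have "(\<lambda>n. (\<Sum>u\<in>S. real (occ u (X n \<omega>))) / L n - 1) \<longlonglongrightarrow> 0"
        proof (rule Lim_null_comparison[rotated], intro always_eventually allI)
          fix n
          have L: "0 < L n" using len[of n] unfolding L_def by linarith
          have "(\<Sum>u\<in>S. real (occ u (X n \<omega>))) / L n - 1 = ((\<Sum>u\<in>S. real (occ u (X n \<omega>))) - L n) / L n"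
            using L by (simp add: diff_divide_distrib)
          then have "norm ((\<Sum>u\<in>S. real (occ u (X n \<omega>))) / L n - 1) = \<bar>(\<Sum>u\<in>S. real (occ u (X n \<omega>))) - L n\<bar> / L n"
            using L by (simp add: abs_divide)
          also have "\<dots> \<le> real l / L n"
            using total_occ_legal[OF legal l, of n] L unfolding S_def L_def by (intro divide_right_mono) auto
          finally show "norm ((\<Sum>u\<in>S. real (occ u (X n \<omega>))) / L n - 1) \<le> real l * (1 / L n)" by simp
        qed
        then show ?thesis by (simp add: LIM_zero_iff)
      qed
    qed (use v in auto)
    then show ?case
      using pf_right_eigenvector_eq[OF fin ne prim less_imp_le[OF r] eig R norm v]
      by (simp add: L_def S_def A_def)
  qed
qed

end
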